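(* The pseudoachromatic index of $\mathrm{PG}(3,2)$ equals $18$: $\psi'(\mathrm{PG}(3,2))=18$.
   Context: $\mathrm{PG}(3,2)$ is the $3$-dimensional projective space over $\mathrm{GF}(2)$ (15 points, 35 lines). A coloring with $k$ colors is a surjective map from the set of lines to $\{1,\dots,k\}$. It is complete if for every pair of distinct colors there is a point lying on a line of each of the two colors. The pseudoachromatic index $\psi'$ is the largest $k$ for which a complete (not necessarily proper) coloring with $k$ colors exists. *)

theory Defs
  imports "HOL-Analysis.Cartesian_Space" "HOL-Library.Z2"
begin

definition pg_points :: "('a::field ^ 'n) set set" where
  "pg_points = {P. vec.subspace P \<and> vec.dim P = 1}"

definition pg_lines :: "('a::field ^ 'n) set set" where
  "pg_lines = {L. vec.subspace L \<and> vec.dim L = 2}"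

text \<open>A geometry is given by its set of points, its set of lines and an incidence relation
  (point first). Colours are the naturals from 1 to k.\<close>

definition line_coloring :: "'l set \<Rightarrow> nat \<Rightarrow> ('l \<Rightarrow> nat) \<Rightarrow> bool" where
  "line_coloring Ls k c \<longleftrightarrow> c ` Ls = {1..k}"

definition complete_coloring ::
  "'p set \<Rightarrow> 'l set \<Rightarrow> ('p \<Rightarrow> 'l \<Rightarrow> bool) \<Rightarrow> nat \<Rightarrow> ('l \<Rightarrow> nat) \<Rightarrow> bool" where
  "complete_coloring Ps Ls I k c \<longleftrightarrow> line_coloring Ls k c \<and>
     (\<forall>i\<in>{1..k}. \<forall>j\<in>{1..k}. i \<noteq> j \<longrightarrow>
        (\<exists>p\<in>Ps. \<exists>l\<in>Ls. \<exists>m\<in>Ls. I p l \<and> I p m \<and> c l = i \<and> c m = j))"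

text \<open>If the set of lines is finite, the number of lines bounds every admissible k, so
  \<open>Max\<close> is taken over a finite nonempty set.\<close>

definition pseudoachromatic_index ::
  "'p set \<Rightarrow> 'l set \<Rightarrow> ('p \<Rightarrow> 'l \<Rightarrow> bool) \<Rightarrow> nat" where
  "pseudoachromatic_index Ps Ls I = Max {k. \<exists>c. complete_coloring Ps Ls I k c}"

end

theory Submission imports Defs begin

text \<open>
  If there are \<open>k \<ge> 19\<close> colours, then, as there are only 35 lines, at least three colours are used
  on a single line each. These three lines meet pairwise, and each of them meets just 18 other
  lines; so \<open>k = 19\<close>, and the 18 neighbours of each of the three lines have pairwise distinct colours.
  Three pairwise meeting lines form a pencil, or have a common point without being coplanar, or
  form a triangle; the last two cases are dual to each other.

  In a pencil, every line meets one of the three, so the colour of a line meeting all three is used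
  only once. There are skew lines of this kind, a contradiction.

  In the second case let \<open>L1, L2, L3\<close> pass through the point \<open>p\<close>. Counting neighbours pairs each of
  the four lines \<open>P12\<close> off \<open>p\<close> in the plane of \<open>L1, L2\<close> with one of the four lines \<open>E12\<close> off \<open>p\<close> in the
  third plane through \<open>L3\<close>; likewise for the other two pairs. A paired class is a vector of four bits
  (its points on \<open>L1\<close>, \<open>L2\<close>, \<open>L3\<close> and on the line \<open>M123\<close> with direction \<open>1 + 2 + 3\<close>), and classes of
  different types meet unless their vectors are complementary. The four remaining lines, the \<open>Q\<close>, lie
  in the plane of \<open>M12, M13, M23\<close>. The colours of these three lines need one \<open>Q\<close> each, so a single \<open>Q\<close>
  is left to help the other classes, and this forces the vectors of at least two types to be odd. Two
  types of odd vectors exhaust all eight odd vectors, while the third type still contains an odd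
  vector whose class has no \<open>Q\<close>; its complement is taken, a contradiction.
\<close>

section \<open>The incidence structure of lines\<close>

text \<open>Names of the 35 lines relative to a basis \<open>p, u1, u2, u3\<close>: \<open>L\<close> and \<open>M\<close> are the lines through \<open>p\<close>,
  indexed by their direction modulo \<open>p\<close>. The others carry bits telling which of the two points \<open>v\<close>
  (\<open>False\<close>) and \<open>p + v\<close> (\<open>True\<close>) they contain, for two of their three directions \<open>v\<close>: \<open>P12 a b\<close> has
  directions 1, 2, 12; \<open>E12 a b\<close> has 3, 123, 12; \<open>Q a b\<close> has 12, 13, 23. Points are coded by their
  coordinates with respect to \<open>p, u1, u2, u3\<close>.\<close>

datatype node = L1 | L2 | L3 | M12 | M13 | M23 | M123
  | P12 bool bool | P13 bool bool | P23 bool bool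
  | E12 bool bool | E13 bool bool | E23 bool bool | Q bool bool

type_synonym code = "bool \<times> bool \<times> bool \<times> bool"

fun pts :: "node \<Rightarrow> code set" where
  "pts L1 = {(True,False,False,False), (False,True,False,False), (True,True,False,False)}"
| "pts L2 = {(True,False,False,False), (False,False,True,False), (True,False,True,False)}"
| "pts L3 = {(True,False,False,False), (False,False,False,True), (True,False,False,True)}"
| "pts M12 = {(True,False,False,False), (False,True,True,False), (True,True,True,False)}"
| "pts M13 = {(True,False,False,False), (False,True,False,True), (True,True,False,True)}"
| "pts M23 = {(True,False,False,False), (False,False,True,True), (True,False,True,True)}"
| "pts M123 = {(True,False,False,False), (False,True,True,True), (True,True,True,True)}"
| "pts (P12 a b) = {(a,True,False,False), (b,False,True,False), (a \<noteq> b,True,True,False)}"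
| "pts (P13 a b) = {(a,True,False,False), (b,False,False,True), (a \<noteq> b,True,False,True)}"
| "pts (P23 a b) = {(a,False,True,False), (b,False,False,True), (a \<noteq> b,False,True,True)}"
| "pts (E12 a b) = {(a,False,False,True), (b,True,True,True), (a \<noteq> b,True,True,False)}"
| "pts (E13 a b) = {(a,False,True,False), (b,True,True,True), (a \<noteq> b,True,False,True)}"
| "pts (E23 a b) = {(a,True,False,False), (b,True,True,True), (a \<noteq> b,False,True,True)}"
| "pts (Q a b) = {(a,True,True,False), (b,True,False,True), (a \<noteq> b,False,True,True)}"

text \<open>The annihilators of the lines \<open>pts n\<close> under the standard bilinear form: a duality, which turns the
  three lines \<open>L1, L2, L3\<close> through a point into a triangle.\<close>

fun dual_pts :: "node \<Rightarrow> code set" where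
  "dual_pts L1 = {(False,False,True,False), (False,False,False,True), (False,False,True,True)}"
| "dual_pts L2 = {(False,True,False,False), (False,False,False,True), (False,True,False,True)}"
| "dual_pts L3 = {(False,True,False,False), (False,False,True,False), (False,True,True,False)}"
| "dual_pts M12 = {(False,True,True,False), (False,False,False,True), (False,True,True,True)}"
| "dual_pts M13 = {(False,True,False,True), (False,False,True,False), (False,True,True,True)}"
| "dual_pts M23 = {(False,False,True,True), (False,True,False,False), (False,True,True,True)}"
| "dual_pts M123 = {(False,True,True,False), (False,True,False,True), (False,False,True,True)}"
| "dual_pts (P12 a b) = {(False,False,False,True), (True,a,b,False), (True,a,b,True)}"
| "dual_pts (P13 a b) = {(False,False,True,False), (True,a,False,b), (True,a,True,b)}"
| "dual_pts (P23 a b) = {(False,True,False,False), (True,False,a,b), (True,True,a,b)}"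
| "dual_pts (E12 a b) = {(False,True,True,False), (True,False,a \<noteq> b,a), (True,True,a = b,a)}"
| "dual_pts (E13 a b) = {(False,True,False,True), (True,False,a,a \<noteq> b), (True,True,a,a = b)}"
| "dual_pts (E23 a b) = {(False,False,True,True), (True,a,False,a \<noteq> b), (True,a,True,a = b)}"
| "dual_pts (Q a b) = {(False,True,True,True), (True,False,a,b), (True,True,\<not> a,\<not> b)}"

text \<open>Every line meets itself under this relation, so counts of neighbours have to exclude it
  explicitly.\<close>

definition meets :: "node \<Rightarrow> node \<Rightarrow> bool" where
  "meets m n \<longleftrightarrow> (\<exists>x\<in>pts m. x \<in> pts n)"

text \<open>Annihilators of two lines share a point iff the lines do not span the whole space, that
  is, iff the lines meet. So one relation \<open>meets\<close> serves for both labellings, and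
  triangles need no argument of their own.\<close>

lemma meets_dual: "(\<exists>x\<in>dual_pts m. x \<in> dual_pts n) \<longleftrightarrow> meets m n"
  unfolding meets_def by (cases m; cases n; simp; blast?)

definition zero_code :: code where
  "zero_code = (False, False, False, False)"

fun add_code :: "code \<Rightarrow> code \<Rightarrow> code" where
  "add_code (t,x,y,z) (t',x',y',z') = (t \<noteq> t', x \<noteq> x', y \<noteq> y', z \<noteq> z')"

text \<open>An explicit list makes statements about all lines executable, so that
  \<open>code_simp\<close> can decide them.\<close>

definition nodes :: "node list" where
  "nodes = [L1, L2, L3, M12, M13, M23, M123] @
     [f a b. f \<leftarrow> [P12, P13, P23, E12, E13, E23, Q], a \<leftarrow> [False, True], b \<leftarrow> [False, True]]"

lemma set_nodes: "set nodes = UNIV"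
proof -
  have "n \<in> set nodes" for n by (cases n; auto simp: nodes_def)
  then show ?thesis by auto
qed

lemma length_nodes: "length nodes = 35" "distinct nodes"
  by (simp_all add: nodes_def)

lemma card_nodes: "card (UNIV :: node set) = 35"
  using distinct_card[of nodes] by (simp add: set_nodes length_nodes)

section \<open>Lines of PG(3,2) in coordinates\<close>

lemma bit_vec_add_self [simp]: "x + x = (0 :: bit ^ 'n)"
  by (simp add: vec_eq_iff)

lemma bit_vec_add_self_left [simp]: "x + (x + y) = (y :: bit ^ 'n)"
  by (simp flip: add.assoc)

lemma bit_vec_add_eq_0 [simp]: "x + y = 0 \<longleftrightarrow> x = (y :: bit ^ 'n)"
  by (metis add.right_neutral bit_vec_add_self_left)

lemma span_pair: "vec.span {x, y} = {0, x, y, x + (y :: bit ^ 'n)}"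
proof -
  have ex_bit: "(\<exists>k :: bit. P k) \<longleftrightarrow> P 0 \<or> P 1" for P
    by (metis bit.exhaust)
  have "v \<in> vec.span {x, y} \<longleftrightarrow> (\<exists>k l. v = k *s x + l *s y)" for v
    by (simp add: vec.span_insert[of x "{y}"] vec.span_singleton image_iff diff_eq_eq add.commute)
  then show ?thesis
    by (auto simp: ex_bit)
qed

lemma span_single: "vec.span {x} = {0, x :: bit ^ 'n}"
  using span_pair[of x x] by auto

text \<open>Over GF(2) the only nonzero vector in the span of a basis \<open>{x, y}\<close> besides
  \<open>x\<close> and \<open>y\<close> is \<open>x + y\<close>.\<close>

lemma pg_line_iff:
  "L \<in> pg_lines \<longleftrightarrow> (\<exists>x y :: bit ^ 'n. x \<noteq> 0 \<and> y \<noteq> 0 \<and> x \<noteq> y \<and> L = {0, x, y, x + y})"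
proof
  assume "L \<in> pg_lines"
  then have L: "vec.subspace L" "vec.dim L = 2" by (auto simp: pg_lines_def)
  obtain B where B: "B \<subseteq> L" "vec.independent B" "L \<subseteq> vec.span B" "card B = vec.dim L"
    using vec.basis_exists by metis
  then obtain x y where xy: "B = {x, y}" "x \<noteq> y" using L(2) by (metis card_2_iff)
  moreover have "L = vec.span B" using B L(1) by (metis vec.span_minimal subset_antisym)
  moreover have "x \<noteq> 0" "y \<noteq> 0" using B(2) vec.dependent_zero xy by auto
  ultimately show "\<exists>x y. x \<noteq> 0 \<and> y \<noteq> 0 \<and> x \<noteq> y \<and> L = {0, x, y, x + y}"
    by (auto simp: span_pair)
next
  assume "\<exists>x y. x \<noteq> 0 \<and> y \<noteq> 0 \<and> x \<noteq> y \<and> L = {0, x, y, x + y}"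
  then obtain x y where xy: "x \<noteq> 0" "y \<noteq> 0" "x \<noteq> y" "L = vec.span {x, y}"
    by (auto simp: span_pair)
  have "vec.independent {x, y}"
    using xy by (auto simp: vec.independent_insert span_single)
  then have "vec.dim L = 2" using xy by (metis card_2_iff vec.dim_span_eq_card_independent)
  then show "L \<in> pg_lines" using xy(4) by (simp add: pg_lines_def)
qed

text \<open>A nonzero vector of a line spans a point on it, so incidence can be treated with vectors
  instead of one-dimensional subspaces.\<close>

lemma common_pg_point_iff:
  assumes "L \<in> pg_lines" "M \<in> pg_lines"
  shows "(\<exists>p\<in>pg_points. p \<subseteq> L \<and> p \<subseteq> M) \<longleftrightarrow> (\<exists>x. x \<noteq> 0 \<and> x \<in> L \<and> x \<in> M)"
proof
  assume "\<exists>p\<in>pg_points. p \<subseteq> L \<and> p \<subseteq> M"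
  then obtain p where p: "vec.dim p = 1" "p \<subseteq> L" "p \<subseteq> M" by (auto simp: pg_points_def)
  have "\<not> p \<subseteq> {0}" using p(1) vec.dim_eq_0 by (metis zero_neq_one)
  then show "\<exists>x. x \<noteq> 0 \<and> x \<in> L \<and> x \<in> M" using p by blast
next
  assume "\<exists>x. x \<noteq> 0 \<and> x \<in> L \<and> x \<in> M"
  then obtain x where x: "x \<noteq> 0" "x \<in> L" "x \<in> M" by blast
  have "vec.span {x} \<subseteq> L" "vec.span {x} \<subseteq> M"
    using assms x vec.span_minimal[of "{x}"] by (auto simp: pg_lines_def)
  moreover have "vec.span {x} \<in> pg_points"
    using x(1) by (simp add: pg_points_def vec.dim_span_eq_card_independent)
  ultimately show "\<exists>p\<in>pg_points. p \<subseteq> L \<and> p \<subseteq> M" by blast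
qed

lemma pg_line_through_two:
  assumes "L \<in> pg_lines" "x \<in> L" "y \<in> L" "x \<noteq> 0" "y \<noteq> 0" "x \<noteq> (y :: bit ^ 'n)"
  shows "L = {0, x, y, x + y}"
proof -
  obtain a b where L: "L = {0, a, b, a + b}" using assms(1) by (auto simp: pg_line_iff)
  have "a + b + b = a" "a + b + a = b" by (simp_all add: add.commute add.left_commute)
  then show ?thesis using assms unfolding L by (auto simp: add.commute)
qed

lemma pg_line_through_point:
  assumes "L \<in> pg_lines" "x \<in> L" "x \<noteq> (0 :: bit ^ 'n)"
  obtains y where "y \<noteq> 0" "y \<noteq> x" "L = {0, x, y, x + y}"
proof -
  obtain a b where L: "L = {0, a, b, a + b}" "a \<noteq> 0" "b \<noteq> 0" "a \<noteq> b" using assms(1) by (auto simp: pg_line_iff)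
  then obtain y where y: "y \<noteq> 0" "y \<noteq> x" "y \<in> L" by (cases "x = a") auto
  then show ?thesis using pg_line_through_two[OF assms(1,2) y(3)] assms(3) that by auto
qed

section \<open>Coordinates with respect to a basis\<close>

fun lin_comb :: "bit ^ 4 \<Rightarrow> bit ^ 4 \<Rightarrow> bit ^ 4 \<Rightarrow> bit ^ 4 \<Rightarrow> code \<Rightarrow> bit ^ 4" where
  "lin_comb v0 v1 v2 v3 (t, x, y, z) =
     (if t then v0 else 0) + (if x then v1 else 0) + (if y then v2 else 0) + (if z then v3 else 0)"

lemma lin_comb_add: "lin_comb v0 v1 v2 v3 (add_code a b) = lin_comb v0 v1 v2 v3 a + lin_comb v0 v1 v2 v3 b"
  by (cases a; cases b) (auto simp: ac_simps)

lemma add_code_eq_0: "add_code a b = zero_code \<longleftrightarrow> a = b"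
  by (cases a; cases b) (auto simp: zero_code_def)

lemma card_bit_vec4: "card (UNIV :: (bit ^ 4) set) = 16"
proof -
  have "(UNIV :: bit set) = {0, 1}" by (auto intro: bit.exhaust)
  then have "card (UNIV :: bit set) = 2" by (metis card_2_iff zero_neq_one)
  then show ?thesis by simp
qed

text \<open>The hypotheses say that each vector lies outside the span of the preceding ones. Thus
  the kernel is trivial, and an injective map between sets of 16 elements is bijective.\<close>

lemma bij_lin_comb:
  assumes "v0 \<noteq> 0" "v1 \<notin> {0, v0}" "v2 \<notin> {0, v0, v1, v0 + v1}"
    "v3 \<notin> {0, v0, v1, v2, v0 + v1, v0 + v2, v1 + v2, v0 + v1 + v2}"
  shows "bij (lin_comb v0 v1 v2 v3)"
proof -
  have ker: "a = zero_code" if "lin_comb v0 v1 v2 v3 a = 0" for a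
    using assms that by (cases a) (auto simp: zero_code_def split: if_splits)
  have "inj (lin_comb v0 v1 v2 v3)"
    by (rule injI) (metis add_code_eq_0 ker lin_comb_add bit_vec_add_self)
  moreover have "card (UNIV :: code set) = card (UNIV :: (bit ^ 4) set)"
    by (simp add: card_bit_vec4 del: CARD_vec flip: UNIV_Times_UNIV)
  moreover have fin: "finite (UNIV :: (bit ^ 4) set)" using card_bit_vec4 by (metis card.infinite zero_neq_numeral)
  ultimately have "card (range (lin_comb v0 v1 v2 v3)) = card (UNIV :: (bit ^ 4) set)"
    by (simp add: card_image)
  then show ?thesis using \<open>inj _\<close> fin by (simp add: bij_def card_subset_eq)
qed


text \<open>\<open>g\<close> lists each line of PG(3,2) in coordinates exactly once, with the zero
  vector left out.\<close>

definition code_lines :: "(node \<Rightarrow> code set) \<Rightarrow> bool" where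
  "code_lines g \<longleftrightarrow>
     (\<forall>n. \<exists>a b. a \<noteq> b \<and> a \<noteq> zero_code \<and> b \<noteq> zero_code \<and> g n = {a, b, add_code a b}) \<and>
     (\<forall>a b. a \<noteq> b \<and> a \<noteq> zero_code \<and> b \<noteq> zero_code \<longrightarrow> (\<exists>n. g n = {a, b, add_code a b})) \<and>
     (\<forall>m n. g m = g n \<longrightarrow> m = n)"

lemma code_lines_nodes:
  "code_lines g \<longleftrightarrow>
     (\<forall>n\<in>set nodes. \<exists>a b. a \<noteq> b \<and> a \<noteq> zero_code \<and> b \<noteq> zero_code \<and> g n = {a, b, add_code a b}) \<and>
     (\<forall>a b. a \<noteq> b \<and> a \<noteq> zero_code \<and> b \<noteq> zero_code \<longrightarrow> (\<exists>n\<in>set nodes. g n = {a, b, add_code a b})) \<and>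
     (\<forall>m\<in>set nodes. \<forall>n\<in>set nodes. g m = g n \<longrightarrow> m = n)"
  by (simp only: code_lines_def set_nodes ball_UNIV bex_UNIV)

lemma code_lines_pts: "code_lines pts" and code_lines_dual_pts: "code_lines dual_pts"
  unfolding code_lines_nodes by (intro conjI; code_simp)+

text \<open>Over GF(2) additive maps are linear, so \<open>e\<close> is a coordinate system of the
  whole space.\<close>

locale frame =
  fixes e :: "code \<Rightarrow> bit ^ 4"
  assumes bij: "bij e" and add: "e (add_code a b) = e a + e b"
begin

lemma e_inj: "e a = e b \<longleftrightarrow> a = b"
  using bij by (simp add: bij_def inj_eq)

lemma e_zero: "e zero_code = 0"
  using add[of zero_code zero_code] by (simp add: zero_code_def)

lemma e_eq_0: "e a = 0 \<longleftrightarrow> a = zero_code"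
  by (metis e_inj e_zero)

lemma labelling:
  assumes "code_lines g"
  shows "bij_betw (\<lambda>n. insert 0 (e ` g n)) UNIV pg_lines"
    and "(\<exists>x. x \<noteq> 0 \<and> x \<in> insert 0 (e ` g m) \<and> x \<in> insert 0 (e ` g n)) \<longleftrightarrow> (\<exists>x\<in>g m. x \<in> g n)"
proof -
  have line: "\<exists>a b. a \<noteq> b \<and> a \<noteq> zero_code \<and> b \<noteq> zero_code \<and> g n = {a, b, add_code a b}" for n
    using assms unfolding code_lines_def by blast
  have onto: "\<exists>n. g n = {a, b, add_code a b}" if "a \<noteq> b" "a \<noteq> zero_code" "b \<noteq> zero_code" for a b
    using assms that unfolding code_lines_def by blast
  have inj: "m = n" if "g m = g n" for m n
    using assms that unfolding code_lines_def by blast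
  have zero: "zero_code \<notin> g n" for n
    using line[of n] by (metis add_code_eq_0 empty_iff insert_iff)
  have nz: "0 \<notin> e ` g n" for n
    by (metis e_eq_0 imageE zero)
  have "inj (\<lambda>n. insert 0 (e ` g n))"
  proof (rule injI)
    fix m n assume "insert 0 (e ` g m) = insert 0 (e ` g n)"
    then have "e ` g m = e ` g n" using nz by (metis Diff_insert_absorb)
    then show "m = n" using inj bij by (metis bij_def inj_image_eq_iff)
  qed
  moreover have "range (\<lambda>n. insert 0 (e ` g n)) = pg_lines"
  proof (intro equalityI subsetI)
    fix L assume "L \<in> range (\<lambda>n. insert 0 (e ` g n))"
    then obtain n where L: "L = insert 0 (e ` g n)" by blast
    obtain a b where ab: "a \<noteq> b" "a \<noteq> zero_code" "b \<noteq> zero_code" "g n = {a, b, add_code a b}"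
      using line by blast
    show "L \<in> pg_lines"
      unfolding pg_line_iff using ab by (intro exI[of _ "e a"] exI[of _ "e b"]) (simp add: L add e_inj e_eq_0)
  next
    fix L :: "(bit ^ 4) set" assume "L \<in> pg_lines"
    then obtain x y where xy: "x \<noteq> 0" "y \<noteq> 0" "x \<noteq> y" "L = {0, x, y, x + y}" by (auto simp: pg_line_iff)
    obtain a b where ab: "x = e a" "y = e b" using bij by (metis bij_pointE)
    then obtain n where "g n = {a, b, add_code a b}" using onto[of a b] xy e_zero by metis
    then have "L = insert 0 (e ` g n)" using xy ab by (simp add: add)
    then show "L \<in> range (\<lambda>n. insert 0 (e ` g n))" by blast
  qed
  ultimately show "bij_betw (\<lambda>n. insert 0 (e ` g n)) UNIV pg_lines"
    by (simp add: bij_betw_def)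
  show "(\<exists>x. x \<noteq> 0 \<and> x \<in> insert 0 (e ` g m) \<and> x \<in> insert 0 (e ` g n)) \<longleftrightarrow> (\<exists>x\<in>g m. x \<in> g n)"
    using nz[of m] by (auto simp: e_inj image_iff)
qed

end

text \<open>Completeness depends only on which lines meet. Hence a labelling has to preserve just
  this relation, and it may come from a duality.\<close>

definition line_labelling :: "(node \<Rightarrow> (bit ^ 4) set) \<Rightarrow> bool" where
  "line_labelling l \<longleftrightarrow> bij_betw l UNIV pg_lines \<and>
     (\<forall>m n. (\<exists>x. x \<noteq> 0 \<and> x \<in> l m \<and> x \<in> l n) \<longleftrightarrow> meets m n)"

context frame begin

lemma line_labelling_pts: "line_labelling (\<lambda>n. insert 0 (e ` pts n))"
  unfolding line_labelling_def meets_def by (intro conjI allI labelling code_lines_pts)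

lemma line_labelling_dual_pts: "line_labelling (\<lambda>n. insert 0 (e ` dual_pts n))"
  unfolding line_labelling_def meets_dual[symmetric] by (intro conjI allI labelling code_lines_dual_pts)

end

text \<open>The reversed basis is for the triangle case, where independence is known from the last
  basis vector to the first.\<close>

lemma frame_lin_comb:
  assumes "v0 \<noteq> 0" "v1 \<notin> {0, v0}" "v2 \<notin> {0, v0, v1, v0 + v1}"
    "v3 \<notin> {0, v0, v1, v2, v0 + v1, v0 + v2, v1 + v2, v0 + v1 + v2}"
  shows "frame (lin_comb v0 v1 v2 v3)" "frame (lin_comb v3 v2 v1 v0)"
proof -
  show 1: "frame (lin_comb v0 v1 v2 v3)"
    by unfold_locales (rule bij_lin_comb[OF assms] lin_comb_add)+
  define rev where "rev = (\<lambda>(t, x, y, z). (z, y, x, t) :: code)"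
  have "lin_comb v3 v2 v1 v0 = lin_comb v0 v1 v2 v3 \<circ> rev"
    by (auto simp: fun_eq_iff rev_def ac_simps)
  moreover have "bij rev" by (rule o_bij[of rev]) (auto simp: rev_def)
  ultimately have "bij (lin_comb v3 v2 v1 v0)"
    using bij_lin_comb[OF assms] by (simp add: bij_comp)
  then show "frame (lin_comb v3 v2 v1 v0)"
    by (intro frame.intro lin_comb_add)
qed

section \<open>Normal form of three pairwise meeting lines\<close>

lemma exists_vector_outside:
  assumes "length xs < 16"
  obtains w :: "bit ^ 4" where "w \<notin> set xs"
proof -
  have "card (set xs) < card (UNIV :: (bit ^ 4) set)"
    unfolding card_bit_vec4 using card_length[of xs] assms by linarith
  then show ?thesis using that by (metis UNIV_I UNIV_eq_I less_irrefl)
qed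

text \<open>The symmetry of the space is used here: \<open>Z = M12\<close> stands for a pencil, and
  \<open>Z = L3\<close> for lines through a point that are not coplanar or, after dualizing, for a
  triangle.\<close>

lemma labelling_three_lines:
  assumes lines: "A \<in> pg_lines" "B \<in> pg_lines" "C \<in> pg_lines"
    and neq: "A \<noteq> B" "A \<noteq> C" "B \<noteq> C"
    and AB: "\<exists>x. x \<noteq> 0 \<and> x \<in> A \<and> x \<in> B" and AC: "\<exists>x. x \<noteq> 0 \<and> x \<in> A \<and> x \<in> C" and BC: "\<exists>x. x \<noteq> 0 \<and> x \<in> B \<and> x \<in> C"
  shows "\<exists>l. \<exists>Z\<in>{L3, M12}. line_labelling l \<and> l L1 = A \<and> l L2 = B \<and> l Z = C"
proof -
  obtain p where p: "p \<noteq> 0" "p \<in> A" "p \<in> B" using AB by blast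
  have same: "K = L" if "K \<in> pg_lines" "L \<in> pg_lines" "x \<noteq> y" "x \<noteq> 0" "y \<noteq> 0" "{x, y} \<subseteq> K \<inter> L" for K L and x y :: "bit ^ 4"
    using pg_line_through_two[OF that(1), of x y] pg_line_through_two[OF that(2), of x y] that by auto
  show ?thesis
  proof (cases "p \<in> C")
    case True
    obtain u1 where u1: "u1 \<noteq> 0" "u1 \<noteq> p" "A = {0, p, u1, p + u1}" using pg_line_through_point[OF lines(1) p(2,1)] .
    obtain u2 where u2: "u2 \<noteq> 0" "u2 \<noteq> p" "B = {0, p, u2, p + u2}" using pg_line_through_point[OF lines(2) p(3,1)] .
    obtain u3 where u3: "u3 \<noteq> 0" "u3 \<noteq> p" "C = {0, p, u3, p + u3}" using pg_line_through_point[OF lines(3) True p(1)] .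
    have u2A: "u2 \<notin> A" using same[OF lines(1,2), of p u2] neq(1) u2 p by auto
    have u3A: "u3 \<notin> A" "u3 \<notin> B" using same[OF lines(1,3), of p u3] same[OF lines(2,3), of p u3] neq u3 p by auto
    \<comment> \<open>The case distinction asks whether the third line lies in the plane spanned by
      \<open>p\<close>, \<open>u1\<close>, \<open>u2\<close>. If so, its direction modulo
      \<open>p\<close> is \<open>u1 + u2\<close>, which is the line \<open>M12\<close>.\<close>
    show ?thesis
    proof (cases "u3 \<in> {0, p, u1, u2, p + u1, p + u2, u1 + u2, p + u1 + u2}")
      case True
      then have u3': "u3 = u1 + u2 \<or> u3 = p + u1 + u2" using u3A u1(3) u2(3) by auto
      obtain w where w: "w \<notin> set [0, p, u1, u2, p + u1, p + u2, u1 + u2, p + u1 + u2]"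
        by (rule exists_vector_outside[of "[0, p, u1, u2, p + u1, p + u2, u1 + u2, p + u1 + u2]"]) simp_all
      interpret frame "lin_comb p u1 u2 w"
        by (rule frame_lin_comb(1)) (use p u1 u2A w in auto)
      have "C = {0, p, u1 + u2, p + u1 + u2}" using u3' u3(3) by (auto simp: ac_simps)
      then show ?thesis
        using u1(3) u2(3) line_labelling_pts
        by (intro exI[of _ "\<lambda>n. insert 0 (lin_comb p u1 u2 w ` pts n)"] bexI[of _ M12]) (simp_all add: ac_simps)
    next
      case False
      interpret frame "lin_comb p u1 u2 u3"
        by (rule frame_lin_comb(1)) (use p u1 u2A False in auto)
      show ?thesis
        using u1(3) u2(3) u3(3) line_labelling_pts
        by (intro exI[of _ "\<lambda>n. insert 0 (lin_comb p u1 u2 u3 ` pts n)"] bexI[of _ L3]) simp_all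
    qed
  next
    case False
    obtain x where x: "x \<noteq> 0" "x \<in> A" "x \<in> C" using AC by blast
    obtain y where y: "y \<noteq> 0" "y \<in> B" "y \<in> C" using BC by blast
    have px: "p \<noteq> x" "p \<noteq> y" using False x y by auto
    have xB: "x \<notin> B" "y \<notin> A" using same[OF lines(1,2), of p x] same[OF lines(1,2), of p y] neq p x y px by auto
    then have xy: "x \<noteq> y" using y by auto
    have A: "A = {0, p, x, p + x}" using pg_line_through_two[OF lines(1) p(2) x(2)] p x px by auto
    have B: "B = {0, p, y, p + y}" using pg_line_through_two[OF lines(2) p(3) y(2)] p y px by auto
    have C: "C = {0, x, y, x + y}" using pg_line_through_two[OF lines(3) x(3) y(3)] x y xy by auto
    obtain w where w: "w \<notin> set [0, p, x, y, p + x, p + y, x + y, p + x + y]"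
      by (rule exists_vector_outside[of "[0, p, x, y, p + x, p + y, x + y, p + x + y]"]) simp_all
    \<comment> \<open>The triangle has the vertices \<open>p\<close>, \<open>x\<close>,
      \<open>y\<close>, and \<open>w\<close> lies off its plane. In \<open>dual_pts\<close> the
      lines \<open>L1\<close>, \<open>L2\<close>, \<open>L3\<close> join the last three unit vectors
      in pairs, hence this order of the basis.\<close>
    interpret frame "lin_comb w y x p"
      by (rule frame_lin_comb(2)) (use p x px xB A w in auto)
    show ?thesis
      using A B C line_labelling_dual_pts
      by (intro exI[of _ "\<lambda>n. insert 0 (lin_comb w y x p ` dual_pts n)"] bexI[of _ L3]) (auto simp: ac_simps)
  qed
qed

lemma exists_line_labelling: "\<exists>l. line_labelling l"
proof -
  obtain v0 :: "bit ^ 4" where v0: "v0 \<notin> set [0]"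
    by (rule exists_vector_outside[of "[0]"]) simp_all
  obtain v1 where v1: "v1 \<notin> set [0, v0]"
    by (rule exists_vector_outside[of "[0, v0]"]) simp_all
  obtain v2 where v2: "v2 \<notin> set [0, v0, v1, v0 + v1]"
    by (rule exists_vector_outside[of "[0, v0, v1, v0 + v1]"]) simp_all
  obtain v3 where v3: "v3 \<notin> set [0, v0, v1, v2, v0 + v1, v0 + v2, v1 + v2, v0 + v1 + v2]"
    by (rule exists_vector_outside[of "[0, v0, v1, v2, v0 + v1, v0 + v2, v1 + v2, v0 + v1 + v2]"]) simp_all
  interpret frame "lin_comb v0 v1 v2 v3"
    by (rule frame_lin_comb(1)) (use v0 v1 v2 v3 in auto)
  show ?thesis using line_labelling_pts by blast
qed

section \<open>Three singleton classes with a common point, not coplanar\<close>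

text \<open>Oddness and injectivity make both families closed under complement, so they are disjoint. Flipping
  the last two coordinates for \<open>S\<close>, the second and the fourth for \<open>T\<close>, leads from an odd vector in
  neither family to one in both.\<close>

lemma two_odd_families:
  fixes S T :: "bool \<Rightarrow> bool \<Rightarrow> bool \<Rightarrow> bool \<Rightarrow> bool"
  assumes S_total: "\<And>a b. \<exists>c d. S a b c d" and T_total: "\<And>a c. \<exists>b d. T a b c d"
    and S_inj: "\<And>a b a' b' c d. S a b c d \<Longrightarrow> S a' b' c d \<Longrightarrow> a = a' \<and> b = b'"
    and T_inj: "\<And>a c a' c' b d. T a b c d \<Longrightarrow> T a' b c' d \<Longrightarrow> a = a' \<and> c = c'"
    and S_odd: "\<And>a b c d. S a b c d \<Longrightarrow> (a \<noteq> b) \<noteq> (c \<noteq> d)"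
    and T_odd: "\<And>a b c d. T a b c d \<Longrightarrow> (a \<noteq> b) \<noteq> (c \<noteq> d)"
    and disj: "\<And>a b c d. S a b c d \<Longrightarrow> \<not> T (\<not> a) (\<not> b) (\<not> c) (\<not> d)"
    and odd: "(a \<noteq> b) \<noteq> (c \<noteq> d)"
  shows "S a b c d \<or> T a b c d"
proof (rule ccontr)
  have S_flip: "S a b c d \<or> S a b (\<not> c) (\<not> d)" if "(a \<noteq> b) \<noteq> (c \<noteq> d)" for a b c d
  proof -
    obtain c' d' where S: "S a b c' d'" using S_total by blast
    show ?thesis using S S_odd[OF S] that by (cases c; cases c'; cases d; cases d'; simp)
  qed
  have T_flip: "T a b c d \<or> T a (\<not> b) c (\<not> d)" if "(a \<noteq> b) \<noteq> (c \<noteq> d)" for a b c d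
  proof -
    obtain b' d' where T: "T a b' c d'" using T_total by blast
    show ?thesis using T T_odd[OF T] that by (cases b; cases b'; cases d; cases d'; simp)
  qed
  \<comment> \<open>The other outcome of \<open>T_flip\<close> shares its second and fourth
    coordinates with the given vector, which \<open>T_inj\<close> excludes.\<close>
  have T_compl: "T (\<not> a) (\<not> b) (\<not> c) (\<not> d)" if "T a b c d" for a b c d
    using T_flip[of "\<not> a" b "\<not> c" d] T_inj[OF that, of "\<not> a" "\<not> c"] T_odd[OF that] by auto
  have no_common: "\<not> (S a b c d \<and> T a b c d)" for a b c d
    using disj[of a b c d] T_compl[of a b c d] by blast
  assume "\<not> (S a b c d \<or> T a b c d)"
  then have "S a b (\<not> c) (\<not> d)" "T a (\<not> b) c (\<not> d)"
    using S_flip[OF odd] T_flip[OF odd] by auto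
  then have "\<not> T a b (\<not> c) (\<not> d)" "\<not> S a (\<not> b) c (\<not> d)"
    using no_common by blast+
  moreover have "S a (\<not> b) c (\<not> d) \<or> S a (\<not> b) (\<not> c) d"
    using S_flip[of a "\<not> b" c "\<not> d"] odd by auto
  moreover have "T a b (\<not> c) (\<not> d) \<or> T a (\<not> b) (\<not> c) d"
    using T_flip[of a b "\<not> c" "\<not> d"] odd by auto
  ultimately show False using no_common by blast
qed

text \<open>\<open>S a b c d\<close>: the line with bits \<open>a, b\<close> has the colour of the line with bits \<open>c, d\<close>; \<open>X a b\<close>: this colour
  also occurs on some \<open>Q\<close>.\<close>

locale pairing =
  fixes S :: "bool \<Rightarrow> bool \<Rightarrow> bool \<Rightarrow> bool \<Rightarrow> bool" and X :: "bool \<Rightarrow> bool \<Rightarrow> bool"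
  assumes total: "\<exists>c d. S a b c d"
    and inj: "S a b c d \<Longrightarrow> S a' b' c d \<Longrightarrow> a = a' \<and> b = b'"
    and X_unique: "X a b \<Longrightarrow> X a' b' \<Longrightarrow> a = a' \<and> b = b'"
    and even: "S a b c d \<Longrightarrow> S a' b' c' d' \<Longrightarrow> (a \<noteq> b) = (c \<noteq> d) \<Longrightarrow> (a' \<noteq> b') = (c' \<noteq> d') \<Longrightarrow>
      (a \<noteq> b) \<noteq> (a' \<noteq> b') \<Longrightarrow> X a b \<or> X a' b'"
begin

text \<open>Otherwise \<open>(a, b)\<close> and the two pairs differing from it in one bit have
  partners with the same value of \<open>c \<noteq> d\<close>. Only two pairs have that value,
  contradicting injectivity.\<close>

lemma opposite_even:
  assumes S: "S a b c d" and "(a \<noteq> b) = (c \<noteq> d)"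
  shows "\<exists>a' b' c' d'. S a' b' c' d' \<and> (a' \<noteq> b') = (c' \<noteq> d') \<and> (a \<noteq> b) \<noteq> (a' \<noteq> b')"
proof (rule ccontr)
  assume neg: "\<not> ?thesis"
  obtain c1 d1 c2 d2 where S1: "S a (\<not> b) c1 d1" and S2: "S (\<not> a) b c2 d2"
    using total by meson
  have "(c1 \<noteq> d1) = (c \<noteq> d)" "(c2 \<noteq> d2) = (c \<noteq> d)"
    using neg S1 S2 assms(2) by blast+
  then consider "c1 = c" "d1 = d" | "c2 = c" "d2 = d" | "c1 = c2" "d1 = d2" by blast
  then show False using inj[of a b c d a "\<not> b"] inj[of a b c d "\<not> a" b] inj[of a "\<not> b" c1 d1 "\<not> a" b] S S1 S2
    by cases auto
qed

text \<open>An even vector would come with an even one of opposite parity, and then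
  \<open>even\<close> puts a \<open>Q\<close> in one of the two classes.\<close>

lemma odd_if_no_X:
  assumes "\<And>a b. \<not> X a b" "S a b c d"
  shows "(a \<noteq> b) \<noteq> (c \<noteq> d)"
  using opposite_even[OF assms(2)] even[OF assms(2)] assms(1) by blast

lemma odd_without_X: "\<exists>a b c d. S a b c d \<and> (a \<noteq> b) \<noteq> (c \<noteq> d) \<and> \<not> X a b"
proof (rule ccontr)
  assume neg: "\<not> ?thesis"
  then have X: "X a b" if "S a b c d" "(a \<noteq> b) \<noteq> (c \<noteq> d)" for a b c d
    using that by blast
  \<comment> \<open>\<open>(a, b)\<close> is the only pair that may satisfy \<open>X\<close>, an
    arbitrary one if none does. The two pairs starting with \<open>\<not> a\<close> then lack
    \<open>X\<close>, so both would be even, with opposite parities.\<close>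
  obtain a b where free: "\<And>a' b'. X a' b' \<Longrightarrow> a' = a \<and> b' = b"
    using X_unique by metis
  obtain c1 d1 c2 d2 where S1: "S (\<not> a) (\<not> b) c1 d1" and S2: "S (\<not> a) b c2 d2"
    using total by meson
  then have "X (\<not> a) (\<not> b) \<or> X (\<not> a) b"
    using X[OF S1] X[OF S2] even[OF S1 S2] by blast
  then show False using free by blast
qed

end

text \<open>Two of the types have no class with a \<open>Q\<close>, so their vectors are odd and
  exhaust all odd vectors. The third type has an odd vector without \<open>Q\<close>, whose
  complement is odd as well and thus taken. Bits are ordered by the directions 1, 2, 3, 123; the
  lambdas move those of the \<open>P\<close> line to the front.\<close>

lemma no_three_pairings:
  fixes S12 S13 S23 :: "bool \<Rightarrow> bool \<Rightarrow> bool \<Rightarrow> bool \<Rightarrow> bool"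
  assumes "pairing S12 X12" "pairing (\<lambda>a c b d. S13 a b c d) X13" "pairing (\<lambda>b c a d. S23 a b c d) X23"
    and X: "\<And>a b c d. \<not> (X12 a b \<and> X13 c d)" "\<And>a b c d. \<not> (X12 a b \<and> X23 c d)" "\<And>a b c d. \<not> (X13 a b \<and> X23 c d)"
    and compl: "\<And>a b c d. S12 a b c d \<Longrightarrow> S13 (\<not> a) (\<not> b) (\<not> c) (\<not> d) \<Longrightarrow> X12 a b \<or> X13 (\<not> a) (\<not> c)"
      "\<And>a b c d. S12 a b c d \<Longrightarrow> S23 (\<not> a) (\<not> b) (\<not> c) (\<not> d) \<Longrightarrow> X12 a b \<or> X23 (\<not> b) (\<not> c)"
      "\<And>a b c d. S13 a b c d \<Longrightarrow> S23 (\<not> a) (\<not> b) (\<not> c) (\<not> d) \<Longrightarrow> X13 a c \<or> X23 (\<not> b) (\<not> c)"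
  shows False
proof -
  interpret p12: pairing S12 X12 by fact
  interpret p13: pairing "\<lambda>a c b d. S13 a b c d" X13 by fact
  interpret p23: pairing "\<lambda>b c a d. S23 a b c d" X23 by fact
  consider "\<forall>a b. \<not> X13 a b \<and> \<not> X23 a b" | "\<forall>a b. \<not> X12 a b \<and> \<not> X23 a b" | "\<forall>a b. \<not> X12 a b \<and> \<not> X13 a b"
    using X by metis
  then show False
  proof cases
    case 1
    obtain a b c d where o: "S12 a b c d" "(a \<noteq> b) \<noteq> (c \<noteq> d)" "\<not> X12 a b"
      using p12.odd_without_X by blast
    have "S13 (\<not> a) (\<not> b) (\<not> c) (\<not> d) \<or> S23 (\<not> a) (\<not> b) (\<not> c) (\<not> d)"
    \<comment> \<open>The \<open>P\<close> lines of types 13 and 23 share direction 3, so the third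
      coordinate is moved to the front. Likewise the second one in the next case.\<close>
    proof (rule two_odd_families[of "\<lambda>c a b d. S13 a b c d" "\<lambda>c a b d. S23 a b c d" "\<not> c" "\<not> a" "\<not> b" "\<not> d"])
      show "\<exists>c d. S13 b c a d" for a b using p13.total by blast
      show "\<exists>b d. S23 b c a d" for a c using p23.total by blast
      show "S13 b c a d \<Longrightarrow> S13 b' c a' d \<Longrightarrow> a = a' \<and> b = b'" for a b a' b' c d using p13.inj by blast
      show "S23 b c a d \<Longrightarrow> S23 b c' a' d \<Longrightarrow> a = a' \<and> c = c'" for a c a' c' b d using p23.inj by blast
      show "S13 b c a d \<Longrightarrow> (a \<noteq> b) \<noteq> (c \<noteq> d)" for a b c d using p13.odd_if_no_X[of b c a d] 1 by blast
      show "S23 b c a d \<Longrightarrow> (a \<noteq> b) \<noteq> (c \<noteq> d)" for a b c d using p23.odd_if_no_X[of b c a d] 1 by blast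
      show "S13 b c a d \<Longrightarrow> \<not> S23 (\<not> b) (\<not> c) (\<not> a) (\<not> d)" for a b c d using compl(3) 1 by blast
      show "((\<not> c) \<noteq> (\<not> a)) \<noteq> ((\<not> b) \<noteq> (\<not> d))" using o(2) by blast
    qed
    then show False using compl(1,2)[OF o(1)] o(3) 1 by blast
  next
    case 2
    obtain a b c d where o: "S13 a b c d" "(a \<noteq> c) \<noteq> (b \<noteq> d)" "\<not> X13 a c"
      using p13.odd_without_X by blast
    have "S12 (\<not> a) (\<not> b) (\<not> c) (\<not> d) \<or> S23 (\<not> a) (\<not> b) (\<not> c) (\<not> d)"
    proof (rule two_odd_families[of "\<lambda>b a c d. S12 a b c d" "\<lambda>b a c d. S23 a b c d" "\<not> b" "\<not> a" "\<not> c" "\<not> d"])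
      show "\<exists>c d. S12 b a c d" for a b using p12.total by blast
      show "\<exists>b d. S23 b a c d" for a c using p23.total by blast
      show "S12 b a c d \<Longrightarrow> S12 b' a' c d \<Longrightarrow> a = a' \<and> b = b'" for a b a' b' c d using p12.inj by blast
      show "S23 b a c d \<Longrightarrow> S23 b a' c' d \<Longrightarrow> a = a' \<and> c = c'" for a c a' c' b d using p23.inj by blast
      show "S12 b a c d \<Longrightarrow> (a \<noteq> b) \<noteq> (c \<noteq> d)" for a b c d using p12.odd_if_no_X[of b a c d] 2 by blast
      show "S23 b a c d \<Longrightarrow> (a \<noteq> b) \<noteq> (c \<noteq> d)" for a b c d using p23.odd_if_no_X[of b a c d] 2 by blast
      show "S12 b a c d \<Longrightarrow> \<not> S23 (\<not> b) (\<not> a) (\<not> c) (\<not> d)" for a b c d using compl(2) 2 by blast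
      show "((\<not> b) \<noteq> (\<not> a)) \<noteq> ((\<not> c) \<noteq> (\<not> d))" using o(2) by blast
    qed
    then show False using compl(1)[of "\<not> a" "\<not> b" "\<not> c" "\<not> d"] compl(3)[OF o(1)] o 2 by auto
  next
    case 3
    obtain a b c d where o: "S23 a b c d" "(b \<noteq> c) \<noteq> (a \<noteq> d)" "\<not> X23 b c"
      using p23.odd_without_X by blast
    have "S12 (\<not> a) (\<not> b) (\<not> c) (\<not> d) \<or> S13 (\<not> a) (\<not> b) (\<not> c) (\<not> d)"
    proof (rule two_odd_families[of S12 S13 "\<not> a" "\<not> b" "\<not> c" "\<not> d"])
      show "\<exists>c d. S12 a b c d" for a b using p12.total by blast
      show "\<exists>b d. S13 a b c d" for a c using p13.total by blast
      show "S12 a b c d \<Longrightarrow> S12 a' b' c d \<Longrightarrow> a = a' \<and> b = b'" for a b a' b' c d using p12.inj by blast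
      show "S13 a b c d \<Longrightarrow> S13 a' b c' d \<Longrightarrow> a = a' \<and> c = c'" for a c a' c' b d using p13.inj by blast
      show "S12 a b c d \<Longrightarrow> (a \<noteq> b) \<noteq> (c \<noteq> d)" for a b c d using p12.odd_if_no_X[of a b c d] 3 by blast
      show "S13 a b c d \<Longrightarrow> (a \<noteq> b) \<noteq> (c \<noteq> d)" for a b c d using p13.odd_if_no_X[of a b c d] 3 by blast
      show "S12 a b c d \<Longrightarrow> \<not> S13 (\<not> a) (\<not> b) (\<not> c) (\<not> d)" for a b c d using compl(1) 3 by blast
      show "((\<not> a) \<noteq> (\<not> b)) \<noteq> ((\<not> c) \<noteq> (\<not> d))" using o(2) by blast
    qed
    then show False using compl(2,3)[of "\<not> a" "\<not> b" "\<not> c" "\<not> d"] o 3 by auto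
  qed
qed

section \<open>Colour classes around three one-line classes\<close>

lemma five_bool_pairs_not_distinct:
  fixes f :: "bool \<times> bool \<Rightarrow> 'a"
  shows "\<not> distinct [f p1, f p2, f p3, f p4, f p5]"
proof
  assume "distinct [f p1, f p2, f p3, f p4, f p5]"
  then have "card {f p1, f p2, f p3, f p4, f p5} = 5"
    using distinct_card by fastforce
  moreover have "card {f p1, f p2, f p3, f p4, f p5} \<le> card (range f)"
    by (rule card_mono) auto
  moreover have "card (range f) \<le> card (UNIV :: (bool \<times> bool) set)"
    by (rule card_image_le) simp
  moreover have "card (UNIV :: (bool \<times> bool) set) = 4"
    by (simp flip: UNIV_Times_UNIV)
  ultimately show False by simp
qed

text \<open>This is the case \<open>Z = L3\<close> for a colouring of the labels. The assumption
  \<open>rainbow\<close> comes from counting the 18 neighbours of each one-line class.\<close>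

locale three_singletons =
  fixes d :: "node \<Rightarrow> nat"
  assumes complete: "d x \<noteq> d y \<Longrightarrow> \<exists>x' y'. d x' = d x \<and> d y' = d y \<and> meets x' y'"
    and alone: "L \<in> {L1, L2, L3} \<Longrightarrow> d x = d L \<Longrightarrow> x = L"
    and rainbow: "L \<in> {L1, L2, L3} \<Longrightarrow> x \<noteq> L \<Longrightarrow> y \<noteq> L \<Longrightarrow> meets L x \<Longrightarrow> meets L y \<Longrightarrow> d x = d y \<Longrightarrow> x = y"
begin

lemma L_class [simp]:
  "d L1 = d x \<longleftrightarrow> x = L1" "d L2 = d x \<longleftrightarrow> x = L2" "d L3 = d x \<longleftrightarrow> x = L3"
  "d x = d L1 \<longleftrightarrow> x = L1" "d x = d L2 \<longleftrightarrow> x = L2" "d x = d L3 \<longleftrightarrow> x = L3"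
  by (metis alone insertCI)+

lemmas rainbow1 = rainbow[of L1, simplified] and rainbow2 = rainbow[of L2, simplified] and rainbow3 = rainbow[of L3, simplified]

text \<open>Any two of the lines \<open>P\<close> meet a common one of \<open>L1\<close>,
  \<open>L2\<close>, \<open>L3\<close>, so \<open>rainbow\<close> separates their colours. The lines
  \<open>M\<close> meet all three, which gives the next two lemmas.\<close>

lemma P_colour: "d (P12 a b) = d (P12 a' b') \<longleftrightarrow> a = a' \<and> b = b'"
  "d (P13 a b) = d (P13 a' b') \<longleftrightarrow> a = a' \<and> b = b'"
  "d (P23 a b) = d (P23 a' b') \<longleftrightarrow> a = a' \<and> b = b'"
  "d (P12 a b) \<noteq> d (P13 a' b')" "d (P12 a b) \<noteq> d (P23 a' b')" "d (P13 a b) \<noteq> d (P23 a' b')"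
  "d (P13 a b) \<noteq> d (P12 a' b')" "d (P23 a b) \<noteq> d (P12 a' b')" "d (P23 a b) \<noteq> d (P13 a' b')"
  using rainbow1[of "P12 a b" "P12 a' b'"] rainbow1[of "P13 a b" "P13 a' b'"] rainbow2[of "P23 a b" "P23 a' b'"]
    rainbow1[of "P12 a b" "P13 a' b'"] rainbow2[of "P12 a b" "P23 a' b'"] rainbow3[of "P13 a b" "P23 a' b'"]
    rainbow1[of "P13 a b" "P12 a' b'"] rainbow2[of "P23 a b" "P12 a' b'"] rainbow3[of "P23 a b" "P13 a' b'"]
  by (auto simp: meets_def)

lemma M_P_colour:
  assumes "m \<in> {M12, M13, M23, M123}"
  shows "d (P12 a b) \<noteq> d m" "d (P13 a b) \<noteq> d m" "d (P23 a b) \<noteq> d m"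
    "d m \<noteq> d (P12 a b)" "d m \<noteq> d (P13 a b)" "d m \<noteq> d (P23 a b)"
  using assms rainbow1[of "P12 a b" m] rainbow1[of "P13 a b" m] rainbow2[of "P23 a b" m]
  by (auto simp: meets_def)

lemma M_colour:
  assumes "m \<in> {M12, M13, M23, M123}" "n \<in> {M12, M13, M23, M123}"
  shows "d m = d n \<longleftrightarrow> m = n"
  using assms rainbow1[of m n]
  by (auto simp: meets_def)

lemma meets_colour:
  assumes "L \<in> {L1, L2, L3}" "x \<noteq> L"
  shows "\<exists>y. y \<noteq> L \<and> meets L y \<and> d y = d x"
  using assms complete[of L x] alone by metis

text \<open>The colour has to occur on a neighbour of \<open>L3\<close>. All of these except the
  \<open>E12\<close> lines also meet \<open>L1\<close> or \<open>L2\<close>, near which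
  \<open>P12 a b\<close> already uses the colour.\<close>

lemma P12_E12: "\<exists>c e. d (P12 a b) = d (E12 c e)"
proof -
  obtain y where y: "y \<noteq> L3" "meets L3 y" "d y = d (P12 a b)"
    using meets_colour[of L3 "P12 a b"] by auto
  show ?thesis
    using y rainbow1[of y "P12 a b"] rainbow2[of y "P12 a b"]
    by (cases y) (auto simp: meets_def, metis)
qed

lemma P13_E13: "\<exists>c e. d (P13 a b) = d (E13 c e)"
proof -
  obtain y where y: "y \<noteq> L2" "meets L2 y" "d y = d (P13 a b)"
    using meets_colour[of L2 "P13 a b"] by auto
  show ?thesis
    using y rainbow1[of y "P13 a b"] rainbow3[of y "P13 a b"]
    by (cases y) (auto simp: meets_def, metis)
qed

lemma P23_E23: "\<exists>c e. d (P23 a b) = d (E23 c e)"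
proof -
  obtain y where y: "y \<noteq> L1" "meets L1 y" "d y = d (P23 a b)"
    using meets_colour[of L1 "P23 a b"] by auto
  show ?thesis
    using y rainbow3[of y "P23 a b"] rainbow2[of y "P23 a b"]
    by (cases y) (auto simp: meets_def, metis)
qed

end

text \<open>Choosing partners gives an injection of a four-element set into itself, hence a
  bijection.\<close>

lemma total_inj_imp_onto:
  fixes f g :: "bool \<Rightarrow> bool \<Rightarrow> 'a"
  assumes "\<And>a b. \<exists>c e. f a b = g c e" "\<And>a b a' b'. f a b = f a' b' \<longleftrightarrow> a = a' \<and> b = b'"
  shows "\<exists>a b. f a b = g c e"
proof -
  obtain h where h: "f a b = case_prod g (h (a, b))" for a b
  proof -
    have "\<forall>p. \<exists>q. case_prod f p = case_prod g q" using assms(1) by auto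
    then obtain h where "\<forall>p. case_prod f p = case_prod g (h p)" by metis
    then show ?thesis using that[of h] by auto
  qed
  have "inj h"
  proof (rule injI)
    fix p q assume "h p = h q"
    then have "f (fst p) (snd p) = f (fst q) (snd q)" by (simp add: h)
    then show "p = q" by (simp add: assms(2) prod_eq_iff)
  qed
  then have "surj h" by (simp add: finite_UNIV_inj_surj)
  then obtain p where "h p = (c, e)" by (metis surjD)
  then show ?thesis using h[of "fst p" "snd p"] by auto
qed

section \<open>Which colours occur on the four lines \<open>Q\<close>\<close>

context three_singletons begin

lemma E12_P12: "\<exists>a b. d (P12 a b) = d (E12 c e)"
  by (rule total_inj_imp_onto[where f="\<lambda>a b. d (P12 a b)" and g="\<lambda>a b. d (E12 a b)"]) (simp_all add: P12_E12 P_colour)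
lemma E13_P13: "\<exists>a b. d (P13 a b) = d (E13 c e)"
  by (rule total_inj_imp_onto[where f="\<lambda>a b. d (P13 a b)" and g="\<lambda>a b. d (E13 a b)"]) (simp_all add: P13_E13 P_colour)
lemma E23_P23: "\<exists>a b. d (P23 a b) = d (E23 c e)"
  by (rule total_inj_imp_onto[where f="\<lambda>a b. d (P23 a b)" and g="\<lambda>a b. d (E23 a b)"]) (simp_all add: P23_E23 P_colour)

lemma E_colour: "d (E12 a b) = d (E12 a' b') \<longleftrightarrow> a = a' \<and> b = b'"
  "d (E13 a b) = d (E13 a' b') \<longleftrightarrow> a = a' \<and> b = b'"
  "d (E23 a b) = d (E23 a' b') \<longleftrightarrow> a = a' \<and> b = b'"
  using rainbow3[of "E12 a b" "E12 a' b'"] rainbow2[of "E13 a b" "E13 a' b'"] rainbow1[of "E23 a b" "E23 a' b'"]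
  by (auto simp: meets_def)

abbreviation q_colour :: "bool \<times> bool \<Rightarrow> nat" where
  "q_colour p \<equiv> d (case_prod Q p)"

text \<open>Every \<open>E\<close> line shares its colour with a \<open>P\<close> line, whose colour
  is not that of an \<open>M\<close>. Only the lines \<open>Q\<close> remain.\<close>

lemma M_class:
  assumes "m \<in> {M12, M13, M23, M123}" "d y = d m"
  shows "y = m \<or> (\<exists>u v. y = Q u v)"
proof (cases y)
  case (E12 c e)
  then show ?thesis using E12_P12[of c e] M_P_colour[OF assms(1)] assms(2) by metis
next
  case (E13 c e)
  then show ?thesis using E13_P13[of c e] M_P_colour[OF assms(1)] assms(2) by metis
next
  case (E23 c e)
  then show ?thesis using E23_P23[of c e] M_P_colour[OF assms(1)] assms(2) by metis
qed (use assms(2) in \<open>simp_all add: M_P_colour[OF assms(1)] M_colour[OF _ assms(1)]\<close>)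

lemma P12_class:
  assumes "d (P12 a b) = d (E12 c e)" "d y = d (P12 a b)"
  shows "y = P12 a b \<or> y = E12 c e \<or> (\<exists>u v. y = Q u v)"
proof (cases y)
  case (E13 a' b')
  then show ?thesis using E13_P13[of a' b'] P_colour assms(2) by metis
next
  case (E23 a' b')
  then show ?thesis using E23_P23[of a' b'] P_colour assms(2) by metis
next
  case (E12 a' b')
  then show ?thesis using assms by (simp add: E_colour)
qed (use assms(2) in \<open>simp_all add: M_P_colour P_colour\<close>)

lemma P13_class:
  assumes "d (P13 a b) = d (E13 c e)" "d y = d (P13 a b)"
  shows "y = P13 a b \<or> y = E13 c e \<or> (\<exists>u v. y = Q u v)"
proof (cases y)
  case (E12 a' b')
  then show ?thesis using E12_P12[of a' b'] P_colour assms(2) by metis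
next
  case (E23 a' b')
  then show ?thesis using E23_P23[of a' b'] P_colour assms(2) by metis
next
  case (E13 a' b')
  then show ?thesis using assms by (simp add: E_colour)
qed (use assms(2) in \<open>simp_all add: M_P_colour P_colour\<close>)

lemma P23_class:
  assumes "d (P23 a b) = d (E23 c e)" "d y = d (P23 a b)"
  shows "y = P23 a b \<or> y = E23 c e \<or> (\<exists>u v. y = Q u v)"
proof (cases y)
  case (E12 a' b')
  then show ?thesis using E12_P12[of a' b'] P_colour assms(2) by metis
next
  case (E13 a' b')
  then show ?thesis using E13_P13[of a' b'] P_colour assms(2) by metis
next
  case (E23 a' b')
  then show ?thesis using assms by (simp add: E_colour)
qed (use assms(2) in \<open>simp_all add: M_P_colour P_colour\<close>)

text \<open>\<open>M12\<close> meets neither \<open>P13\<close> nor \<open>E13\<close> lines. If the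
  class of \<open>P13 a b\<close> contains no \<open>Q\<close>, some \<open>Q\<close> coloured like
  \<open>M12\<close> has to meet one of its two lines, which is possible only in direction 13. The
  next five lemmas are analogous.\<close>

lemma M12_P13:
  assumes "d (P13 a b) = d (E13 c e)"
  shows "(\<exists>u v. d (Q u v) = d (P13 a b)) \<or>
    (\<exists>u v. d (Q u v) = d M12 \<and> (v = (a \<noteq> b) \<or> v = (c \<noteq> e)))"
proof -
  obtain x y where x: "d x = d M12" and y: "d y = d (P13 a b)" and xy: "meets x y"
    using complete[of M12 "P13 a b"] M_P_colour by auto
  have "\<not> meets M12 (P13 a b)" "\<not> meets M12 (E13 c e)"
    "meets (Q u v) (P13 a b) \<Longrightarrow> v = (a \<noteq> b)" "meets (Q u v) (E13 c e) \<Longrightarrow> v = (c \<noteq> e)" for u v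
    by (auto simp: meets_def)
  then show ?thesis
    using M_class[OF _ x] P13_class[OF assms y] x y xy by blast
qed

lemma M12_P23:
  assumes "d (P23 a b) = d (E23 c e)"
  shows "(\<exists>u v. d (Q u v) = d (P23 a b)) \<or>
    (\<exists>u v. d (Q u v) = d M12 \<and> ((u \<noteq> v) = (a \<noteq> b) \<or> (u \<noteq> v) = (c \<noteq> e)))"
proof -
  obtain x y where x: "d x = d M12" and y: "d y = d (P23 a b)" and xy: "meets x y"
    using complete[of M12 "P23 a b"] M_P_colour by auto
  have "\<not> meets M12 (P23 a b)" "\<not> meets M12 (E23 c e)"
    "meets (Q u v) (P23 a b) \<Longrightarrow> (u \<noteq> v) = (a \<noteq> b)" "meets (Q u v) (E23 c e) \<Longrightarrow> (u \<noteq> v) = (c \<noteq> e)" for u v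
    by (auto simp: meets_def)
  then show ?thesis
    using M_class[OF _ x] P23_class[OF assms y] x y xy by blast
qed

lemma M13_P12:
  assumes "d (P12 a b) = d (E12 c e)"
  shows "(\<exists>u v. d (Q u v) = d (P12 a b)) \<or>
    (\<exists>u v. d (Q u v) = d M13 \<and> (u = (a \<noteq> b) \<or> u = (c \<noteq> e)))"
proof -
  obtain x y where x: "d x = d M13" and y: "d y = d (P12 a b)" and xy: "meets x y"
    using complete[of M13 "P12 a b"] M_P_colour by auto
  have "\<not> meets M13 (P12 a b)" "\<not> meets M13 (E12 c e)"
    "meets (Q u v) (P12 a b) \<Longrightarrow> u = (a \<noteq> b)" "meets (Q u v) (E12 c e) \<Longrightarrow> u = (c \<noteq> e)" for u v
    by (auto simp: meets_def)
  then show ?thesis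
    using M_class[OF _ x] P12_class[OF assms y] x y xy by blast
qed

lemma M13_P23:
  assumes "d (P23 a b) = d (E23 c e)"
  shows "(\<exists>u v. d (Q u v) = d (P23 a b)) \<or>
    (\<exists>u v. d (Q u v) = d M13 \<and> ((u \<noteq> v) = (a \<noteq> b) \<or> (u \<noteq> v) = (c \<noteq> e)))"
proof -
  obtain x y where x: "d x = d M13" and y: "d y = d (P23 a b)" and xy: "meets x y"
    using complete[of M13 "P23 a b"] M_P_colour by auto
  have "\<not> meets M13 (P23 a b)" "\<not> meets M13 (E23 c e)"
    "meets (Q u v) (P23 a b) \<Longrightarrow> (u \<noteq> v) = (a \<noteq> b)" "meets (Q u v) (E23 c e) \<Longrightarrow> (u \<noteq> v) = (c \<noteq> e)" for u v
    by (auto simp: meets_def)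
  then show ?thesis
    using M_class[OF _ x] P23_class[OF assms y] x y xy by blast
qed

lemma M23_P12:
  assumes "d (P12 a b) = d (E12 c e)"
  shows "(\<exists>u v. d (Q u v) = d (P12 a b)) \<or>
    (\<exists>u v. d (Q u v) = d M23 \<and> (u = (a \<noteq> b) \<or> u = (c \<noteq> e)))"
proof -
  obtain x y where x: "d x = d M23" and y: "d y = d (P12 a b)" and xy: "meets x y"
    using complete[of M23 "P12 a b"] M_P_colour by auto
  have "\<not> meets M23 (P12 a b)" "\<not> meets M23 (E12 c e)"
    "meets (Q u v) (P12 a b) \<Longrightarrow> u = (a \<noteq> b)" "meets (Q u v) (E12 c e) \<Longrightarrow> u = (c \<noteq> e)" for u v
    by (auto simp: meets_def)
  then show ?thesis
    using M_class[OF _ x] P12_class[OF assms y] x y xy by blast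
qed

lemma M23_P13:
  assumes "d (P13 a b) = d (E13 c e)"
  shows "(\<exists>u v. d (Q u v) = d (P13 a b)) \<or>
    (\<exists>u v. d (Q u v) = d M23 \<and> (v = (a \<noteq> b) \<or> v = (c \<noteq> e)))"
proof -
  obtain x y where x: "d x = d M23" and y: "d y = d (P13 a b)" and xy: "meets x y"
    using complete[of M23 "P13 a b"] M_P_colour by auto
  have "\<not> meets M23 (P13 a b)" "\<not> meets M23 (E13 c e)"
    "meets (Q u v) (P13 a b) \<Longrightarrow> v = (a \<noteq> b)" "meets (Q u v) (E13 c e) \<Longrightarrow> v = (c \<noteq> e)" for u v
    by (auto simp: meets_def)
  then show ?thesis
    using M_class[OF _ x] P13_class[OF assms y] x y xy by blast
qed

text \<open>Each line of one pair shares exactly one direction with each line of the other pair, and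
  complementary bits give different points there. Only a \<open>Q\<close> can make the two classes
  meet.\<close>

lemma P12_P13:
  assumes "d (P12 a1 a2) = d (E12 a3 a4)" "d (P13 (\<not> a1) (\<not> a3)) = d (E13 (\<not> a2) (\<not> a4))"
  shows "(\<exists>u v. d (Q u v) = d (P12 a1 a2)) \<or> (\<exists>u v. d (Q u v) = d (P13 (\<not> a1) (\<not> a3)))"
proof -
  obtain x y where x: "d x = d (P12 a1 a2)" and y: "d y = d (P13 (\<not> a1) (\<not> a3))" and xy: "meets x y"
    using complete[of "P12 a1 a2" "P13 (\<not> a1) (\<not> a3)"] P_colour by auto
  show ?thesis
    using P12_class[OF assms(1) x] P13_class[OF assms(2) y] x y xy by (auto simp: meets_def)
qed

lemma P12_P23:
  assumes "d (P12 a1 a2) = d (E12 a3 a4)" "d (P23 (\<not> a2) (\<not> a3)) = d (E23 (\<not> a1) (\<not> a4))"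
  shows "(\<exists>u v. d (Q u v) = d (P12 a1 a2)) \<or> (\<exists>u v. d (Q u v) = d (P23 (\<not> a2) (\<not> a3)))"
proof -
  obtain x y where x: "d x = d (P12 a1 a2)" and y: "d y = d (P23 (\<not> a2) (\<not> a3))" and xy: "meets x y"
    using complete[of "P12 a1 a2" "P23 (\<not> a2) (\<not> a3)"] P_colour by auto
  show ?thesis
    using P12_class[OF assms(1) x] P23_class[OF assms(2) y] x y xy by (auto simp: meets_def)
qed

lemma P13_P23:
  assumes "d (P13 a1 a3) = d (E13 a2 a4)" "d (P23 (\<not> a2) (\<not> a3)) = d (E23 (\<not> a1) (\<not> a4))"
  shows "(\<exists>u v. d (Q u v) = d (P13 a1 a3)) \<or> (\<exists>u v. d (Q u v) = d (P23 (\<not> a2) (\<not> a3)))"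
proof -
  obtain x y where x: "d x = d (P13 a1 a3)" and y: "d y = d (P23 (\<not> a2) (\<not> a3))" and xy: "meets x y"
    using complete[of "P13 a1 a3" "P23 (\<not> a2) (\<not> a3)"] P_colour by auto
  show ?thesis
    using P13_class[OF assms(1) x] P23_class[OF assms(2) y] x y xy by (auto simp: meets_def)
qed

text \<open>Otherwise each \<open>P13\<close> class and each \<open>P23\<close> class needs its own
  \<open>Q\<close>. Five of these colours already exceed the four lines.\<close>

lemma Q_M12: "\<exists>u v. d (Q u v) = d M12"
proof (rule ccontr)
  assume neg: "\<not> ?thesis"
  have 1: "\<exists>p. q_colour p = d (P13 a b)" for a b
    using P13_E13[of a b] M12_P13[of a b] neg by (auto simp: split_paired_Ex)
  have 2: "\<exists>p. q_colour p = d (P23 False False)"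
    using P23_E23[of False False] M12_P23[of False False] neg by (auto simp: split_paired_Ex)
  obtain p1 p2 p3 p4 p5 where "q_colour p1 = d (P13 False False)" "q_colour p2 = d (P13 False True)"
    "q_colour p3 = d (P13 True False)" "q_colour p4 = d (P13 True True)"
    "q_colour p5 = d (P23 False False)"
    using 1 2 by metis
  then have "distinct [q_colour p1, q_colour p2, q_colour p3, q_colour p4, q_colour p5]"
    by (simp add: P_colour)
  then show False
    by (rule notE[OF five_bool_pairs_not_distinct])
qed

lemma Q_M13: "\<exists>u v. d (Q u v) = d M13"
proof (rule ccontr)
  assume neg: "\<not> ?thesis"
  have 1: "\<exists>p. q_colour p = d (P12 a b)" for a b
    using P12_E12[of a b] M13_P12[of a b] neg by (auto simp: split_paired_Ex)
  have 2: "\<exists>p. q_colour p = d (P23 False False)"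
    using P23_E23[of False False] M13_P23[of False False] neg by (auto simp: split_paired_Ex)
  obtain p1 p2 p3 p4 p5 where "q_colour p1 = d (P12 False False)" "q_colour p2 = d (P12 False True)"
    "q_colour p3 = d (P12 True False)" "q_colour p4 = d (P12 True True)"
    "q_colour p5 = d (P23 False False)"
    using 1 2 by metis
  then have "distinct [q_colour p1, q_colour p2, q_colour p3, q_colour p4, q_colour p5]"
    by (simp add: P_colour)
  then show False
    by (rule notE[OF five_bool_pairs_not_distinct])
qed

lemma Q_M23: "\<exists>u v. d (Q u v) = d M23"
proof (rule ccontr)
  assume neg: "\<not> ?thesis"
  have 1: "\<exists>p. q_colour p = d (P12 a b)" for a b
    using P12_E12[of a b] M23_P12[of a b] neg by (auto simp: split_paired_Ex)
  have 2: "\<exists>p. q_colour p = d (P13 False False)"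
    using P13_E13[of False False] M23_P13[of False False] neg by (auto simp: split_paired_Ex)
  obtain p1 p2 p3 p4 p5 where "q_colour p1 = d (P12 False False)" "q_colour p2 = d (P12 False True)"
    "q_colour p3 = d (P12 True False)" "q_colour p4 = d (P12 True True)"
    "q_colour p5 = d (P13 False False)"
    using 1 2 by metis
  then have "distinct [q_colour p1, q_colour p2, q_colour p3, q_colour p4, q_colour p5]"
    by (simp add: P_colour)
  then show False
    by (rule notE[OF five_bool_pairs_not_distinct])
qed

text \<open>Three of the four lines \<open>Q\<close> are spent on the colours of \<open>M12\<close>,
  \<open>M13\<close>, \<open>M23\<close>.\<close>

lemma Q_colour_unique:
  assumes "\<exists>u v. d (Q u v) = d x" "\<exists>u v. d (Q u v) = d y"
    and "d x \<notin> {d M12, d M13, d M23}" "d y \<notin> {d M12, d M13, d M23}"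
  shows "d x = d y"
proof (rule ccontr)
  assume "d x \<noteq> d y"
  moreover obtain p1 p2 p3 p4 p5 where "q_colour p1 = d M12" "q_colour p2 = d M13" "q_colour p3 = d M23"
    "q_colour p4 = d x" "q_colour p5 = d y"
    using Q_M12 Q_M13 Q_M23 assms(1,2) by (metis case_prod_conv)
  moreover have "d M12 \<noteq> d M13" "d M12 \<noteq> d M23" "d M13 \<noteq> d M23" by (simp_all add: M_colour)
  ultimately have "distinct [q_colour p4, q_colour p5, q_colour p1, q_colour p2, q_colour p3]"
    using assms(3,4) by simp
  then show False
    by (rule notE[OF five_bool_pairs_not_distinct])
qed

text \<open>In an even class the \<open>P12\<close> and the \<open>E12\<close> line have the same
  point in direction 12. Without help, two such classes with different points require two lines
  \<open>Q\<close> of the colour of \<open>M13\<close> and two of that of \<open>M23\<close>; with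
  the one for \<open>M12\<close> these are five.\<close>

lemma even_P12_Q:
  assumes 1: "d (P12 a b) = d (E12 c e)" "(a \<noteq> b) = (c \<noteq> e)"
    and 2: "d (P12 a' b') = d (E12 c' e')" "(a' \<noteq> b') = (c' \<noteq> e')"
    and "(a \<noteq> b) \<noteq> (a' \<noteq> b')"
  shows "(\<exists>u v. d (Q u v) = d (P12 a b)) \<or> (\<exists>u v. d (Q u v) = d (P12 a' b'))"
proof (rule ccontr)
  assume neg: "\<not> ?thesis"
  define f where "f = (\<lambda>p :: bool \<times> bool. fst p)"
  \<comment> \<open>Lines \<open>Q\<close> of equal colour are told apart by their point in
    direction 12, so the pigeonhole argument runs on both data together.\<close>
  define g where "g = (\<lambda>p. (q_colour p, f p))"
  have "\<exists>u v. d (Q u v) = d M13 \<and> u = (a \<noteq> b)" "\<exists>u v. d (Q u v) = d M13 \<and> u = (a' \<noteq> b')"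
    "\<exists>u v. d (Q u v) = d M23 \<and> u = (a \<noteq> b)" "\<exists>u v. d (Q u v) = d M23 \<and> u = (a' \<noteq> b')"
    using M13_P12[OF 1(1)] M13_P12[OF 2(1)] M23_P12[OF 1(1)] M23_P12[OF 2(1)] neg
    unfolding 1(2) 2(2) by blast+
  then have "\<exists>p. q_colour p = d M13 \<and> f p = (a \<noteq> b)" "\<exists>p. q_colour p = d M13 \<and> f p = (a' \<noteq> b')"
    "\<exists>p. q_colour p = d M23 \<and> f p = (a \<noteq> b)" "\<exists>p. q_colour p = d M23 \<and> f p = (a' \<noteq> b')"
    unfolding f_def split_paired_Ex by simp_all
  then obtain p1 p2 p3 p4 where "q_colour p1 = d M13" "f p1 = (a \<noteq> b)" "q_colour p2 = d M13" "f p2 = (a' \<noteq> b')"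
    "q_colour p3 = d M23" "f p3 = (a \<noteq> b)" "q_colour p4 = d M23" "f p4 = (a' \<noteq> b')"
    by blast
  moreover obtain p5 where "q_colour p5 = d M12"
    using Q_M12 by (metis case_prod_conv)
  moreover have "d M12 \<noteq> d M13" "d M12 \<noteq> d M23" "d M13 \<noteq> d M23" by (simp_all add: M_colour)
  ultimately have "distinct [g p1, g p2, g p3, g p4, g p5]"
    unfolding g_def using assms(5) by auto
  then show False
    by (rule notE[OF five_bool_pairs_not_distinct])
qed

lemma even_P13_Q:
  assumes 1: "d (P13 a b) = d (E13 c e)" "(a \<noteq> b) = (c \<noteq> e)"
    and 2: "d (P13 a' b') = d (E13 c' e')" "(a' \<noteq> b') = (c' \<noteq> e')"
    and "(a \<noteq> b) \<noteq> (a' \<noteq> b')"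
  shows "(\<exists>u v. d (Q u v) = d (P13 a b)) \<or> (\<exists>u v. d (Q u v) = d (P13 a' b'))"
proof (rule ccontr)
  assume neg: "\<not> ?thesis"
  define f where "f = (\<lambda>p :: bool \<times> bool. snd p)"
  define g where "g = (\<lambda>p. (q_colour p, f p))"
  have "\<exists>u v. d (Q u v) = d M12 \<and> v = (a \<noteq> b)" "\<exists>u v. d (Q u v) = d M12 \<and> v = (a' \<noteq> b')"
    "\<exists>u v. d (Q u v) = d M23 \<and> v = (a \<noteq> b)" "\<exists>u v. d (Q u v) = d M23 \<and> v = (a' \<noteq> b')"
    using M12_P13[OF 1(1)] M12_P13[OF 2(1)] M23_P13[OF 1(1)] M23_P13[OF 2(1)] neg
    unfolding 1(2) 2(2) by blast+
  then have "\<exists>p. q_colour p = d M12 \<and> f p = (a \<noteq> b)" "\<exists>p. q_colour p = d M12 \<and> f p = (a' \<noteq> b')"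
    "\<exists>p. q_colour p = d M23 \<and> f p = (a \<noteq> b)" "\<exists>p. q_colour p = d M23 \<and> f p = (a' \<noteq> b')"
    unfolding f_def split_paired_Ex by simp_all
  then obtain p1 p2 p3 p4 where "q_colour p1 = d M12" "f p1 = (a \<noteq> b)" "q_colour p2 = d M12" "f p2 = (a' \<noteq> b')"
    "q_colour p3 = d M23" "f p3 = (a \<noteq> b)" "q_colour p4 = d M23" "f p4 = (a' \<noteq> b')"
    by blast
  moreover obtain p5 where "q_colour p5 = d M13"
    using Q_M13 by (metis case_prod_conv)
  moreover have "d M12 \<noteq> d M13" "d M12 \<noteq> d M23" "d M13 \<noteq> d M23" by (simp_all add: M_colour)
  ultimately have "distinct [g p1, g p2, g p3, g p4, g p5]"
    unfolding g_def using assms(5) by auto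
  then show False
    by (rule notE[OF five_bool_pairs_not_distinct])
qed

lemma even_P23_Q:
  assumes 1: "d (P23 a b) = d (E23 c e)" "(a \<noteq> b) = (c \<noteq> e)"
    and 2: "d (P23 a' b') = d (E23 c' e')" "(a' \<noteq> b') = (c' \<noteq> e')"
    and "(a \<noteq> b) \<noteq> (a' \<noteq> b')"
  shows "(\<exists>u v. d (Q u v) = d (P23 a b)) \<or> (\<exists>u v. d (Q u v) = d (P23 a' b'))"
proof (rule ccontr)
  assume neg: "\<not> ?thesis"
  define f where "f = (\<lambda>p :: bool \<times> bool. (fst p \<noteq> snd p))"
  define g where "g = (\<lambda>p. (q_colour p, f p))"
  have "\<exists>u v. d (Q u v) = d M12 \<and> (u \<noteq> v) = (a \<noteq> b)" "\<exists>u v. d (Q u v) = d M12 \<and> (u \<noteq> v) = (a' \<noteq> b')"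
    "\<exists>u v. d (Q u v) = d M13 \<and> (u \<noteq> v) = (a \<noteq> b)" "\<exists>u v. d (Q u v) = d M13 \<and> (u \<noteq> v) = (a' \<noteq> b')"
    using M12_P23[OF 1(1)] M12_P23[OF 2(1)] M13_P23[OF 1(1)] M13_P23[OF 2(1)] neg
    unfolding 1(2) 2(2) by simp_all
  then have "\<exists>p. q_colour p = d M12 \<and> f p = (a \<noteq> b)" "\<exists>p. q_colour p = d M12 \<and> f p = (a' \<noteq> b')"
    "\<exists>p. q_colour p = d M13 \<and> f p = (a \<noteq> b)" "\<exists>p. q_colour p = d M13 \<and> f p = (a' \<noteq> b')"
    unfolding f_def split_paired_Ex by simp_all
  then obtain p1 p2 p3 p4 where "q_colour p1 = d M12" "f p1 = (a \<noteq> b)" "q_colour p2 = d M12" "f p2 = (a' \<noteq> b')"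
    "q_colour p3 = d M13" "f p3 = (a \<noteq> b)" "q_colour p4 = d M13" "f p4 = (a' \<noteq> b')"
    by blast
  moreover obtain p5 where "q_colour p5 = d M23"
    using Q_M23 by (metis case_prod_conv)
  moreover have "d M12 \<noteq> d M13" "d M12 \<noteq> d M23" "d M13 \<noteq> d M23" by (simp_all add: M_colour)
  ultimately have "distinct [g p1, g p2, g p3, g p4, g p5]"
    unfolding g_def using assms(5) by auto
  then show False
    by (rule notE[OF five_bool_pairs_not_distinct])
qed

lemma impossible: False
proof (rule no_three_pairings)
  let ?X12 = "\<lambda>a b. \<exists>u v. d (Q u v) = d (P12 a b)"
  let ?X13 = "\<lambda>a b. \<exists>u v. d (Q u v) = d (P13 a b)"
  let ?X23 = "\<lambda>a b. \<exists>u v. d (Q u v) = d (P23 a b)"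
  let ?S12 = "\<lambda>a b c e. d (P12 a b) = d (E12 c e)"
  let ?S13 = "\<lambda>a b c e. d (P13 a c) = d (E13 b e)"
  let ?S23 = "\<lambda>a b c e. d (P23 b c) = d (E23 a e)"
  show "pairing ?S12 ?X12"
  proof
    show "\<exists>c e. d (P12 a b) = d (E12 c e)" for a b
      by (rule P12_E12)
    show "a = a' \<and> b = b'" if "d (P12 a b) = d (E12 c e)" "d (P12 a' b') = d (E12 c e)" for a b a' b' c e
      using that by (simp flip: P_colour(1))
    show "a = a' \<and> b = b'" if "?X12 a b" "?X12 a' b'" for a b a' b'
      using Q_colour_unique[OF that] by (simp add: M_P_colour P_colour)
  qed (rule even_P12_Q)
  show "pairing (\<lambda>a c b d. ?S13 a b c d) ?X13"
  proof
    show "\<exists>c e. d (P13 a b) = d (E13 c e)" for a b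
      by (rule P13_E13)
    show "a = a' \<and> b = b'" if "d (P13 a b) = d (E13 c e)" "d (P13 a' b') = d (E13 c e)" for a b a' b' c e
      using that by (simp flip: P_colour(2))
    show "a = a' \<and> b = b'" if "?X13 a b" "?X13 a' b'" for a b a' b'
      using Q_colour_unique[OF that] by (simp add: M_P_colour P_colour)
  qed (rule even_P13_Q)
  show "pairing (\<lambda>b c a d. ?S23 a b c d) ?X23"
  proof
    show "\<exists>c e. d (P23 a b) = d (E23 c e)" for a b
      by (rule P23_E23)
    show "a = a' \<and> b = b'" if "d (P23 a b) = d (E23 c e)" "d (P23 a' b') = d (E23 c e)" for a b a' b' c e
      using that by (simp flip: P_colour(3))
    show "a = a' \<and> b = b'" if "?X23 a b" "?X23 a' b'" for a b a' b'
      using Q_colour_unique[OF that] by (simp add: M_P_colour P_colour)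
  qed (rule even_P23_Q)
  show "\<not> (?X12 a b \<and> ?X13 a' b')" for a b a' b'
    using Q_colour_unique[of "P12 a b" "P13 a' b'"] by (auto simp: M_P_colour P_colour)
  show "\<not> (?X12 a b \<and> ?X23 a' b')" for a b a' b'
    using Q_colour_unique[of "P12 a b" "P23 a' b'"] by (auto simp: M_P_colour P_colour)
  show "\<not> (?X13 a b \<and> ?X23 a' b')" for a b a' b'
    using Q_colour_unique[of "P13 a b" "P23 a' b'"] by (auto simp: M_P_colour P_colour)
  show "\<And>a b c d. ?S12 a b c d \<Longrightarrow> ?S13 (\<not> a) (\<not> b) (\<not> c) (\<not> d) \<Longrightarrow> ?X12 a b \<or> ?X13 (\<not> a) (\<not> c)"
    by (rule P12_P13)
  show "\<And>a b c d. ?S12 a b c d \<Longrightarrow> ?S23 (\<not> a) (\<not> b) (\<not> c) (\<not> d) \<Longrightarrow> ?X12 a b \<or> ?X23 (\<not> b) (\<not> c)"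
    by (rule P12_P23)
  show "\<And>a b c d. ?S13 a b c d \<Longrightarrow> ?S23 (\<not> a) (\<not> b) (\<not> c) (\<not> d) \<Longrightarrow> ?X13 a c \<or> ?X23 (\<not> b) (\<not> c)"
    by (rule P13_P23)
qed

end

section \<open>Neighbours of a singleton class and the pencil case\<close>

text \<open>A line has three points, each of them on six further lines.\<close>

lemma card_meeting: "card {n. n \<noteq> m \<and> meets m n} = 18"
proof -
  have "\<forall>m\<in>set nodes. length (filter (\<lambda>n. n \<noteq> m \<and> meets m n) nodes) = 18"
    by code_simp
  moreover have "{n. n \<noteq> m \<and> meets m n} = set (filter (\<lambda>n. n \<noteq> m \<and> meets m n) nodes)"
    by (simp add: set_nodes)
  ultimately show ?thesis
    using length_nodes(2) by (simp only: distinct_card distinct_filter set_nodes) simp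
qed

text \<open>Each of the at least 18 colours other than that of \<open>L\<close> has to occur among
  the 18 neighbours of \<open>L\<close>, so none occurs there twice.\<close>

lemma inj_on_meeting_singleton:
  fixes d :: "node \<Rightarrow> nat"
  assumes complete: "\<And>x y. d x \<noteq> d y \<Longrightarrow> \<exists>x' y'. d x' = d x \<and> d y' = d y \<and> meets x' y'"
    and card: "19 \<le> card (range d)" and alone: "\<And>x. d x = d L \<Longrightarrow> x = L"
  shows "inj_on d {y. y \<noteq> L \<and> meets L y}"
proof (rule eq_card_imp_inj_on)
  let ?N = "{y. y \<noteq> L \<and> meets L y}"
  have fin: "finite S" for S :: "node set"
    by (metis List.finite_set finite_subset set_nodes subset_UNIV)
  show "finite ?N" by (rule fin)
  have "range d - {d L} \<subseteq> d ` ?N"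
  proof
    fix i assume "i \<in> range d - {d L}"
    then obtain x where x: "i = d x" "d x \<noteq> d L" by auto
    then obtain x' y' where "d x' = d L" "d y' = d x" "meets x' y'" using complete[of L x] by metis
    then show "i \<in> d ` ?N" using alone x by (metis (mono_tags, lifting) image_eqI mem_Collect_eq)
  qed
  then have "card (range d - {d L}) \<le> card (d ` ?N)" by (rule card_mono[rotated]) (simp add: fin)
  moreover have "card (range d - {d L}) = card (range d) - 1" by simp
  ultimately have "18 \<le> card (d ` ?N)" using card by simp
  moreover have "card (d ` ?N) \<le> card ?N" by (rule card_image_le) (rule fin)
  ultimately show "card (d ` ?N) = card ?N" by (simp add: card_meeting)
qed

text \<open>Every line has a point in the plane of the pencil, hence on one of its three lines. A
  line meeting all three is therefore alone in its colour.\<close>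

lemma no_pencil:
  fixes d :: "node \<Rightarrow> nat"
  assumes complete: "\<And>x y. d x \<noteq> d y \<Longrightarrow> \<exists>x' y'. d x' = d x \<and> d y' = d y \<and> meets x' y'"
    and alone: "\<And>L x. L \<in> {L1, L2, M12} \<Longrightarrow> d x = d L \<Longrightarrow> x = L"
    and rainbow: "\<And>L. L \<in> {L1, L2, M12} \<Longrightarrow> inj_on d {y. y \<noteq> L \<and> meets L y}"
  shows False
proof -
  \<comment> \<open>\<open>M123\<close> passes through the centre of the pencil outside its plane,
    and \<open>P12 False False\<close> lies in the plane off the centre. Both meet all three lines
    but not each other.\<close>
  have single: "y = x" if "x \<in> {M123, P12 False False}" "d y = d x" for x y
  proof (rule ccontr)
    assume "y \<noteq> x"
    have "y \<in> {L1, L2, M12} \<or> (\<exists>L\<in>{L1, L2, M12}. meets L y)"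
      by (cases y) (auto simp: meets_def)
    moreover have "x \<noteq> L \<and> meets L x" if "L \<in> {L1, L2, M12}" for L
      using that \<open>x \<in> _\<close> by (auto simp: meets_def)
    ultimately show False
      using rainbow that(2) \<open>y \<noteq> x\<close> alone[of y x] unfolding inj_on_def by (metis (mono_tags, lifting) mem_Collect_eq)
  qed
  have "d M123 \<noteq> d (P12 False False)" using single by blast
  then obtain x y where "d x = d M123" "d y = d (P12 False False)" "meets x y"
    using complete by blast
  then have "meets M123 (P12 False False)" using single by blast
  then show False by (simp add: meets_def)
qed

section \<open>A complete colouring with 18 colours\<close>

text \<open>Found by simulated annealing.\<close>

fun node_colour :: "node \<Rightarrow> nat" where
  "node_colour L1 = 7"
| "node_colour L2 = 13"
| "node_colour L3 = 15"
| "node_colour M12 = 17"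
| "node_colour M13 = 3"
| "node_colour M23 = 2"
| "node_colour M123 = 9"
| "node_colour (P12 False False) = 18"
| "node_colour (P12 False True) = 1"
| "node_colour (P12 True False) = 3"
| "node_colour (P12 True True) = 16"
| "node_colour (P13 False False) = 12"
| "node_colour (P13 False True) = 11"
| "node_colour (P13 True False) = 10"
| "node_colour (P13 True True) = 6"
| "node_colour (P23 False False) = 1"
| "node_colour (P23 False True) = 16"
| "node_colour (P23 True False) = 11"
| "node_colour (P23 True True) = 12"
| "node_colour (E12 False False) = 9"
| "node_colour (E12 False True) = 8"
| "node_colour (E12 True False) = 6"
| "node_colour (E12 True True) = 13"
| "node_colour (E13 False False) = 18"
| "node_colour (E13 False True) = 14"
| "node_colour (E13 True False) = 5"
| "node_colour (E13 True True) = 10"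
| "node_colour (E23 False False) = 5"
| "node_colour (E23 False True) = 4"
| "node_colour (E23 True False) = 8"
| "node_colour (E23 True True) = 14"
| "node_colour (Q False False) = 2"
| "node_colour (Q False True) = 15"
| "node_colour (Q True False) = 4"
| "node_colour (Q True True) = 17"

lemma node_colour_image: "node_colour ` UNIV = {1..18}"
  unfolding set_nodes[symmetric] by code_simp

lemma node_colour_complete:
  "\<forall>i\<in>{1..18}. \<forall>j\<in>{1..18}. i \<noteq> j \<longrightarrow>
     (\<exists>m\<in>set nodes. node_colour m = i \<and> (\<exists>n\<in>set nodes. node_colour n = j \<and> meets m n))"
  by code_simp

section \<open>The pseudoachromatic index\<close>

lemma no_node_colouring:
  fixes d :: "node \<Rightarrow> nat"
  assumes complete: "\<And>x y. d x \<noteq> d y \<Longrightarrow> \<exists>x' y'. d x' = d x \<and> d y' = d y \<and> meets x' y'"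
    and card: "19 \<le> card (range d)"
    and Z: "Z \<in> {L3, M12}"
    and alone: "\<And>L x. L \<in> {L1, L2, Z} \<Longrightarrow> d x = d L \<Longrightarrow> x = L"
  shows False
proof -
  have rainbow: "inj_on d {y. y \<noteq> L \<and> meets L y}" if "L \<in> {L1, L2, Z}" for L
    using inj_on_meeting_singleton[of d L] complete card alone[OF that] by blast
  show False
  proof (cases "Z = L3")
    case True
    interpret three_singletons d
    proof
      show "x = y" if "L \<in> {L1, L2, L3}" "x \<noteq> L" "y \<noteq> L" "meets L x" "meets L y" "d x = d y" for L x y
        by (rule inj_onD[OF rainbow[of L]]) (use that True in auto)
    qed (use complete alone True in blast)+
    show False by (rule impossible)
  next
    case False
    then show False using no_pencil[of d] complete alone rainbow Z by blast
  qed
qed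

lemma complete_coloring_PG32_iff:
  "complete_coloring (pg_points :: (bit ^ 'n) set set) pg_lines (\<subseteq>) k c \<longleftrightarrow>
     c ` pg_lines = {1..k} \<and>
     (\<forall>i\<in>{1..k}. \<forall>j\<in>{1..k}. i \<noteq> j \<longrightarrow>
       (\<exists>L\<in>pg_lines. \<exists>M\<in>pg_lines. c L = i \<and> c M = j \<and> (\<exists>x. x \<noteq> 0 \<and> x \<in> L \<and> x \<in> M)))"
proof -
  have "(\<exists>p\<in>pg_points. \<exists>L\<in>pg_lines. \<exists>M\<in>pg_lines. p \<subseteq> L \<and> p \<subseteq> M \<and> c L = i \<and> c M = j) \<longleftrightarrow>
    (\<exists>L\<in>pg_lines. \<exists>M\<in>pg_lines. c L = i \<and> c M = j \<and> (\<exists>p\<in>pg_points. p \<subseteq> L \<and> p \<subseteq> M))" for i j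
    by blast
  also have "\<dots> i j \<longleftrightarrow>
    (\<exists>L\<in>pg_lines. \<exists>M\<in>pg_lines. c L = i \<and> c M = j \<and> (\<exists>x. x \<noteq> 0 \<and> x \<in> L \<and> x \<in> M))" for i j
    by (intro bex_cong conj_cong refl common_pg_point_iff)
  finally show ?thesis
    unfolding complete_coloring_def line_coloring_def by simp
qed

lemma complete_coloring_18:
  "\<exists>c. complete_coloring (pg_points :: (bit ^ 4) set set) pg_lines (\<subseteq>) 18 c"
proof -
  obtain l where "line_labelling l" using exists_line_labelling by blast
  then have bij: "bij_betw l UNIV pg_lines"
    and meet: "\<And>m n. (\<exists>x. x \<noteq> 0 \<and> x \<in> l m \<and> x \<in> l n) \<longleftrightarrow> meets m n"
    by (auto simp: line_labelling_def)
  define c where "c = node_colour \<circ> inv l"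
  have c: "c (l n) = node_colour n" for n
    using bij by (simp add: c_def bij_betw_def inv_f_f)
  have lines: "pg_lines = range l" using bij by (simp add: bij_betw_def)
  have "c ` pg_lines = {1..18}"
    using node_colour_image by (simp add: lines image_image c)
  moreover have "\<exists>L\<in>pg_lines. \<exists>M\<in>pg_lines. c L = i \<and> c M = j \<and> (\<exists>x. x \<noteq> 0 \<and> x \<in> L \<and> x \<in> M)"
    if ij: "i \<in> {1..18}" "j \<in> {1..18}" "i \<noteq> j" for i j
  proof -
    obtain m n where "node_colour m = i" "node_colour n = j" "meets m n"
      using node_colour_complete[rule_format, OF ij] by blast
    then show ?thesis unfolding lines using c meet by (metis rangeI)
  qed
  ultimately show ?thesis unfolding complete_coloring_PG32_iff by blast
qed

text \<open>Adding 1 to the size of each one-element class makes every class count at least 2; then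
  sum over the colours.\<close>

lemma card_singleton_classes:
  fixes c :: "'a \<Rightarrow> nat"
  assumes "finite A" "c ` A = {1..k}"
  shows "2 * k \<le> card A + card {i \<in> {1..k}. card {x \<in> A. c x = i} = 1}"
proof -
  have "1 \<le> card {x \<in> A. c x = i}" if "i \<in> {1..k}" for i
  proof -
    have "i \<in> c ` A" using that assms(2) by simp
    then have "{x \<in> A. c x = i} \<noteq> {}" by auto
    then show ?thesis using assms(1) by (simp add: Suc_le_eq card_gt_0_iff)
  qed
  then have "2 \<le> card {x \<in> A. c x = i} + (if card {x \<in> A. c x = i} = 1 then 1 else 0)"
    if "i \<in> {1..k}" for i
    using that by fastforce
  then have "(\<Sum>i=1..k. 2) \<le> (\<Sum>i=1..k. card {x \<in> A. c x = i} + (if card {x \<in> A. c x = i} = 1 then 1 else 0))"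
    by (intro sum_mono) simp
  moreover have "card A = (\<Sum>i=1..k. card {x \<in> A. c x = i})"
    using sum.image_gen[OF assms(1), of "\<lambda>_. 1 :: nat" c] assms(2) by simp
  ultimately show ?thesis by (simp add: sum.distrib sum.If_cases Int_def)
qed

lemma complete_coloring_le_18:
  assumes "complete_coloring (pg_points :: (bit ^ 4) set set) pg_lines (\<subseteq>) k c"
  shows "k \<le> 18"
proof (rule ccontr)
  assume "\<not> k \<le> 18"
  then have k: "19 \<le> k" by simp
  have image: "c ` pg_lines = {1..k}"
    and complete: "\<And>i j. i \<in> {1..k} \<Longrightarrow> j \<in> {1..k} \<Longrightarrow> i \<noteq> j \<Longrightarrow>
      \<exists>L\<in>pg_lines. \<exists>M\<in>pg_lines. c L = i \<and> c M = j \<and> (\<exists>x. x \<noteq> 0 \<and> x \<in> L \<and> x \<in> M)"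
    using assms unfolding complete_coloring_PG32_iff by blast+
  have card: "card (pg_lines :: (bit ^ 4) set set) = 35"
    using exists_line_labelling bij_betw_same_card by (fastforce simp: line_labelling_def card_nodes)
  then have fin: "finite (pg_lines :: (bit ^ 4) set set)"
    by (metis card.infinite zero_neq_numeral)
  let ?S = "{i \<in> {1..k}. card {L \<in> pg_lines. c L = i} = 1}"
  \<comment> \<open>With 35 lines this is \<open>2 * 19 - 35\<close>.\<close>
  have "3 \<le> card ?S"
    using card_singleton_classes[OF fin image] card k by linarith
  from obtain_subset_with_card_n[OF this] obtain T where T: "T \<subseteq> ?S" "card T = 3"
    by blast
  then obtain i1 i2 i3 where i: "{i1, i2, i3} \<subseteq> ?S" "i1 \<noteq> i2" "i1 \<noteq> i3" "i2 \<noteq> i3"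
    by (auto simp: card_3_iff)
  define single where "single A \<longleftrightarrow> A \<in> pg_lines \<and> (\<forall>L\<in>pg_lines. c L = c A \<longrightarrow> L = A)" for A
  have ex_single: "\<exists>A. single A \<and> c A = i" if "i \<in> ?S" for i
  proof -
    have "card {L \<in> pg_lines. c L = i} = 1" using that by simp
    then obtain A where "{L \<in> pg_lines. c L = i} = {A}" by (rule card_1_singletonE)
    then have "A \<in> pg_lines" "c A = i" "\<forall>L\<in>pg_lines. c L = i \<longrightarrow> L = A" by blast+
    then show ?thesis by (auto simp: single_def)
  qed
  \<comment> \<open>Both colours occur on a single line, so the lines witnessing completeness can
    only be \<open>A\<close> and \<open>B\<close>.\<close>
  have common: "\<exists>x. x \<noteq> 0 \<and> x \<in> A \<and> x \<in> B" if AB: "single A" "single B" "c A \<noteq> c B" for A B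
  proof -
    have "c A \<in> {1..k}" "c B \<in> {1..k}" using AB(1,2) unfolding image[symmetric] single_def by blast+
    then obtain L M where "L \<in> pg_lines" "M \<in> pg_lines" "c L = c A" "c M = c B" "\<exists>x. x \<noteq> 0 \<and> x \<in> L \<and> x \<in> M"
      using complete[OF _ _ AB(3)] by blast
    then show ?thesis using AB by (auto simp: single_def)
  qed
  have "i1 \<in> ?S" "i2 \<in> ?S" "i3 \<in> ?S" using i(1) by simp_all
  then obtain A B C where A: "single A" "c A = i1" and B: "single B" "c B = i2" and C: "single C" "c C = i3"
    using ex_single[of i1] ex_single[of i2] ex_single[of i3] by blast
  have lines: "A \<in> pg_lines" "B \<in> pg_lines" "C \<in> pg_lines" using A B C by (simp_all add: single_def)
  have "\<exists>x. x \<noteq> 0 \<and> x \<in> A \<and> x \<in> B" "\<exists>x. x \<noteq> 0 \<and> x \<in> A \<and> x \<in> C" "\<exists>x. x \<noteq> 0 \<and> x \<in> B \<and> x \<in> C"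
    using i A B C by (simp_all add: common)
  moreover have "A \<noteq> B" "A \<noteq> C" "B \<noteq> C" using i A B C by auto
  ultimately obtain l Z where Z: "Z \<in> {L3, M12}" and l: "line_labelling l" "l L1 = A" "l L2 = B" "l Z = C"
    using labelling_three_lines[OF lines] by blast
  have bij: "bij_betw l UNIV pg_lines"
    and meet: "\<And>m n. (\<exists>x. x \<noteq> 0 \<and> x \<in> l m \<and> x \<in> l n) \<longleftrightarrow> meets m n"
    using l(1) by (auto simp: line_labelling_def)
  have range: "range l = pg_lines" and inj: "inj l" using bij by (auto simp: bij_betw_def)
  have mem: "l n \<in> pg_lines" for n using range by blast
  show False
  proof (rule no_node_colouring[of "\<lambda>n. c (l n)" Z])
    show "\<exists>x' y'. c (l x') = c (l x) \<and> c (l y') = c (l y) \<and> meets x' y'" if xy: "c (l x) \<noteq> c (l y)" for x y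
    proof -
      have "c (l x) \<in> {1..k}" "c (l y) \<in> {1..k}" using image mem by blast+
      then obtain L M where LM: "L \<in> range l" "M \<in> range l" "c L = c (l x)" "c M = c (l y)" "\<exists>x. x \<noteq> 0 \<and> x \<in> L \<and> x \<in> M"
        using complete[OF _ _ xy] unfolding range by blast
      then show ?thesis using meet by (metis rangeE)
    qed
    have "range (\<lambda>n. c (l n)) = {1..k}" using image by (simp add: range[symmetric] image_image)
    then show "19 \<le> card (range (\<lambda>n. c (l n)))" using k by simp
    show "Z \<in> {L3, M12}" by fact
    show "x = L" if "L \<in> {L1, L2, Z}" "c (l x) = c (l L)" for L x
    proof -
      have "single (l L)" using that(1) l A B C by auto
      then have "l x = l L" using that(2) mem by (simp add: single_def)
      then show ?thesis using inj by (simp add: inj_eq)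
    qed
  qed
qed

theorem theorem6:
  "pseudoachromatic_index (pg_points :: (bit ^ 4) set set) (pg_lines :: (bit ^ 4) set set) (\<subseteq>) = 18"
  unfolding pseudoachromatic_index_def
proof (rule Max_eqI)
  show "finite {k. \<exists>c. complete_coloring (pg_points :: (bit ^ 4) set set) pg_lines (\<subseteq>) k c}"
    by (rule finite_subset[of _ "{..18}"]) (use complete_coloring_le_18 in auto)
qed (use complete_coloring_le_18 complete_coloring_18 in auto)

end
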